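(* For every $n\ge 1$ there exists a unique multiplicative homomorphism (that is, a $k$-linear map compatible with products, not required to preserve the unit) $s_n:H_n\to K_n$ such that $$\pi_n\circ s_n=\mathrm{id}_{H_n}$$ and $$s_n(x)\,y=y\,s_n(x)=0\quad\text{for all }x\in H_n\text{ and all }y\in I_n .$$
   Context: Let $k=\mathbb{Q}(\alpha,s)$ be the field of rational functions in two variables. $K_n$ denotes the Birman-Murakami-Wenzl algebra: the $k$-module generated by isotopy classes of framed unoriented tangles in $D^2\times[0,1]$ with $n$ standard boundary points (on a line) at the bottom and the same $n$ points at the top, modulo the Kauffman skein relations: (positive crossing) $-$ (negative crossing) $=(s-s^{-1})\big($(two vertical strands) $-$ (cup-cap)$\big)$; a positive (resp. negative) kink can be removed at the cost of a factor $\alpha$ (resp. $\alpha^{-1}$); a disjoint unknotted circle can be removed at the cost of a factor $\frac{\alpha-\alpha^{-1}}{s-s^{-1}}+1$. The product $fg$ is $f$ followed by $g$ (stacking). Equivalently $K_n$ is the unital $k$-algebra generated by invertible elements $e_1,\dots,e_{n-1}$ (positive crossings of strands $i,i+1$) and $h_1,\dots,h_{n-1}$ (hooks, i.e. cup-caps on strands $i,i+1$) with relations $e_ie_{i+1}e_i=e_{i+1}e_ie_{i+1}$; $e_ie_j=e_je_i$ for $|i-j|\ge2$; $h_ie_i=\alpha^{-1}h_i$; $h_ie_{i-1}^{\pm1}h_i=\alpha^{\pm1}h_i$; $e_i-e_i^{-1}=(s-s^{-1})(1-h_i)$. $I_n\subset K_n$ is the two-sided ideal generated by $h_{n-1}$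 (with $I_1=0$). The quotient $H_n=K_n/I_n$ is the Hecke algebra (generated by the images of the $e_i$, subject to the braid relations and $e_i-e_i^{-1}=s-s^{-1}$), and $\pi_n:K_n\to H_n$ is the canonical projection. *)

theory Defs
  imports
    "HOL-Library.Poly_Mapping"
    "HOL-Library.FuncSet"
    "HOL-Computational_Algebra.Polynomial"
    "HOL-Computational_Algebra.Fraction_Field"
    "HOL-Algebra.QuotRing"
    "HOL-Algebra.Module"
begin

text \<open>
  The ground field \<open>\<rat>(\<alpha>, s)\<close>: the fraction field of \<open>\<rat>[s][\<alpha>]\<close>
  (inner variable \<open>s\<close>, outer variable \<open>\<alpha>\<close>).
\<close>

type_synonym kfield = "rat poly poly fract"

definition k_s :: kfield where
  "k_s = Fract [:[:0, 1:]:] 1"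

definition k_alpha :: kfield where
  "k_alpha = Fract [:0, 1:] 1"


text \<open>
  The free monoid, written additively so that \<open>'g word \<Rightarrow>\<^sub>0 'k\<close> with its convolution product
  is the free associative algebra: \<open>Poly_Mapping.single w c\<close> is the scalar multiple \<open>c w\<close>
  of the monomial \<open>w\<close>.
\<close>

datatype 'g word = Word (letters: "'g list")

instantiation word :: (type) monoid_add
begin

definition zero_word :: "'a word" where
  "0 = Word []"

definition plus_word :: "'a word \<Rightarrow> 'a word \<Rightarrow> 'a word" where
  "v + w = Word (letters v @ letters w)"

instance
  by standard (simp_all add: zero_word_def plus_word_def)

end

definition free_algebra ::
    "'g set \<Rightarrow> ('k::comm_ring_1, 'g word \<Rightarrow>\<^sub>0 'k) module" where
  "free_algebra G =
     \<lparr>carrier = {f. \<forall>w \<in> Poly_Mapping.keys f. set (letters w) \<subseteq> G},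
      mult = (*), one = 1, zero = 0, add = (+),
      smult = (\<lambda>c f. Poly_Mapping.single 0 c * f)\<rparr>"

text \<open>
  \<open>A Quot I\<close> forgets scalar multiplication; here the induced one,
  \<open>c \<odot> (I +> x) = I +> (c \<odot> x)\<close>, is kept, written in the style of \<^const>\<open>rcoset_mult\<close>.
\<close>

definition quotient_algebra ::
    "('k, 'a, 'm) module_scheme \<Rightarrow> 'a set \<Rightarrow> ('k, 'a set) module" where
  "quotient_algebra A I =
     ring.extend (A Quot I)
       (module.fields (\<lambda>c X. \<Union>x\<in>X. I +>\<^bsub>A\<^esub> (c \<odot>\<^bsub>A\<^esub> x)))"

text \<open>Linear and compatible with products; preservation of the unit is deliberately not required.\<close>

definition multiplicative_hom ::
    "('k, 'a, 'm) module_scheme \<Rightarrow> ('k, 'b, 'l) module_scheme \<Rightarrow> ('a \<Rightarrow> 'b) \<Rightarrow> bool" where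
  "multiplicative_hom A B f \<longleftrightarrow>
     f \<in> carrier A \<rightarrow> carrier B \<and>
     (\<forall>x \<in> carrier A. \<forall>y \<in> carrier A. f (x \<oplus>\<^bsub>A\<^esub> y) = f x \<oplus>\<^bsub>B\<^esub> f y) \<and>
     (\<forall>c. \<forall>x \<in> carrier A. f (c \<odot>\<^bsub>A\<^esub> x) = c \<odot>\<^bsub>B\<^esub> f x) \<and>
     (\<forall>x \<in> carrier A. \<forall>y \<in> carrier A. f (x \<otimes>\<^bsub>A\<^esub> y) = f x \<otimes>\<^bsub>B\<^esub> f y)"


text \<open>\<open>PosX i\<close>, \<open>NegX i\<close>, \<open>Hook i\<close> stand for \<open>e\<^sub>i\<close>, \<open>e\<^sub>i\<inverse>\<close>, \<open>h\<^sub>i\<close>.\<close>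

datatype bmw_gen = PosX nat | NegX nat | Hook nat

definition bmw_gens :: "nat \<Rightarrow> bmw_gen set" where
  "bmw_gens n = PosX ` {1..<n} \<union> NegX ` {1..<n} \<union> Hook ` {1..<n}"

type_synonym bmw_free = "bmw_gen word \<Rightarrow>\<^sub>0 kfield"

abbreviation gen :: "bmw_gen \<Rightarrow> bmw_free" where
  "gen g \<equiv> Poly_Mapping.single (Word [g]) 1"

abbreviation pe :: "nat \<Rightarrow> bmw_free" where "pe i \<equiv> gen (PosX i)"
abbreviation ne :: "nat \<Rightarrow> bmw_free" where "ne i \<equiv> gen (NegX i)"
abbreviation hk :: "nat \<Rightarrow> bmw_free" where "hk i \<equiv> gen (Hook i)"

abbreviation scal :: "kfield \<Rightarrow> bmw_free" where
  "scal c \<equiv> Poly_Mapping.single 0 c"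

text \<open>The relators of the presentation: a relation \<open>l = r\<close> is recorded as \<open>l - r\<close>.\<close>

inductive_set bmw_relators :: "nat \<Rightarrow> bmw_free set" for n :: nat where
  inv_right: "1 \<le> i \<Longrightarrow> i < n \<Longrightarrow> pe i * ne i - 1 \<in> bmw_relators n"
| inv_left: "1 \<le> i \<Longrightarrow> i < n \<Longrightarrow> ne i * pe i - 1 \<in> bmw_relators n"
| braid: "1 \<le> i \<Longrightarrow> i + 1 < n \<Longrightarrow>
    pe i * pe (i + 1) * pe i - pe (i + 1) * pe i * pe (i + 1) \<in> bmw_relators n"
| far_comm: "1 \<le> i \<Longrightarrow> i < n \<Longrightarrow> 1 \<le> j \<Longrightarrow> j < n \<Longrightarrow> i + 2 \<le> j \<or> j + 2 \<le> i \<Longrightarrow>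
    pe i * pe j - pe j * pe i \<in> bmw_relators n"
| kink: "1 \<le> i \<Longrightarrow> i < n \<Longrightarrow>
    hk i * pe i - scal (inverse k_alpha) * hk i \<in> bmw_relators n"
| hook_pos: "2 \<le> i \<Longrightarrow> i < n \<Longrightarrow>
    hk i * pe (i - 1) * hk i - scal k_alpha * hk i \<in> bmw_relators n"
| hook_neg: "2 \<le> i \<Longrightarrow> i < n \<Longrightarrow>
    hk i * ne (i - 1) * hk i - scal (inverse k_alpha) * hk i \<in> bmw_relators n"
| skein: "1 \<le> i \<Longrightarrow> i < n \<Longrightarrow>
    pe i - ne i - scal (k_s - inverse k_s) * (1 - hk i) \<in> bmw_relators n"

abbreviation BMW_free :: "nat \<Rightarrow> (kfield, bmw_free) module" where
  "BMW_free n \<equiv> free_algebra (bmw_gens n)"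

definition BMW_rel :: "nat \<Rightarrow> bmw_free set" where
  "BMW_rel n = Idl\<^bsub>BMW_free n\<^esub> (bmw_relators n)"

text \<open>The algebra \<open>K\<^sub>n\<close>.\<close>

definition BMW :: "nat \<Rightarrow> (kfield, bmw_free set) module" where
  "BMW n = quotient_algebra (BMW_free n) (BMW_rel n)"

definition bmw_hook :: "nat \<Rightarrow> nat \<Rightarrow> bmw_free set" where
  "bmw_hook n i = BMW_rel n +>\<^bsub>BMW_free n\<^esub> hk i"

text \<open>The ideal \<open>I\<^sub>n\<close>, the quotient \<open>H\<^sub>n = K\<^sub>n / I\<^sub>n\<close>, and the projection \<open>\<pi>\<^sub>n\<close>.\<close>

definition hook_ideal :: "nat \<Rightarrow> bmw_free set set" where
  "hook_ideal n =
     (if 2 \<le> n then Idl\<^bsub>BMW n\<^esub> {bmw_hook n (n - 1)} else {\<zero>\<^bsub>BMW n\<^esub>})"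

definition Hecke :: "nat \<Rightarrow> (kfield, bmw_free set set) module" where
  "Hecke n = quotient_algebra (BMW n) (hook_ideal n)"

definition hecke_proj :: "nat \<Rightarrow> bmw_free set \<Rightarrow> bmw_free set set" where
  "hecke_proj n x = hook_ideal n +>\<^bsub>BMW n\<^esub> x"

end

theory Submission
  imports Defs "HOL-Algebra.Subrings"
begin

text \<open>
  The statement says that the extension of \<open>H\<^sub>n\<close> by \<open>I\<^sub>n\<close> splits as a product of algebras, and for this it
  is enough that the ideal \<open>I\<^sub>n\<close> has a unit element \<open>1 - z\<close>: then \<open>x \<mapsto> z x\<close> factors through \<open>H\<^sub>n\<close>,
  is the required section, and is the only one (\<open>unique_section_annihilating_ideal\<close>). So one has to
  find \<open>z\<close> with \<open>1 - z \<in> I\<^sub>n\<close> and \<open>z I\<^sub>n = I\<^sub>n z = 0\<close>.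

  The element \<open>z\<close> is a polynomial in the full twist \<open>T\<^sub>n\<close>, which is central in \<open>K\<^sub>n\<close>
  (\<open>bmw_twist_central\<close>) and separates \<open>I\<^sub>n\<close> from \<open>H\<^sub>n\<close> by its eigenvalues. In the Hecke algebra, \<open>T\<^sub>n\<close>
  is the product of the commuting Jucys--Murphy elements; an intertwiner argument shows that each of
  these, hence also \<open>T\<^sub>n\<close>, satisfies a polynomial \<open>f\<close> whose roots are even powers of \<open>s\<close>
  (\<open>L_annihilated\<close>, \<open>T_annihilated\<close>). In \<open>K\<^sub>n\<close> this means \<open>f(T\<^sub>n) \<in> I\<^sub>n\<close>.

  On the ideal, a hook can be pulled through the full twist: \<open>T\<^sub>n h\<^bsub>n-1\<^esub> = \<alpha>\<^sup>-\<^sup>2 T\<^bsub>n-2\<^esub> h\<^bsub>n-1\<^esub>\<close>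
  (\<open>T_h\<close>). By induction on the number of strands, \<open>T\<^bsub>n-2\<^esub>\<close> satisfies a polynomial whose roots are of the
  form \<open>\<alpha>\<^bsup>-2k\<^esup> s\<^bsup>2j\<^esup>\<close> with \<open>k \<ge> 0\<close>. Multiplying these roots by \<open>\<alpha>\<^sup>-\<^sup>2\<close> gives a polynomial \<open>g\<close> with
  \<open>g(T\<^sub>n) I\<^sub>n = 0\<close>, and \<open>f g\<close> kills \<open>T\<^sub>n\<close>, which closes the induction (\<open>twist_annihilated\<close>).

  Because \<open>\<alpha>\<close> and \<open>s\<close> are independent, \<open>f\<close> and \<open>g\<close> have no common root, so \<open>u f + v g = 1\<close> for
  some polynomials \<open>u\<close> and \<open>v\<close>, and \<open>z = v(T\<^sub>n) g(T\<^sub>n)\<close> is as required (\<open>hook_ideal_complement\<close>).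
\<close>

section \<open>Polynomials in an element of an algebra over a field\<close>

text \<open>
  Associative unital algebras, in general noncommutative, in the form in which \<^const>\<open>BMW\<close> and
  \<^const>\<open>Hecke\<close> come: the algebra is a record, but its field of scalars is a type. The scalars are
  central by the last two axioms.
\<close>

locale scalar_algebra = ring A for A :: "('k::field, 'a, 'm) module_scheme" (structure) +
  assumes smult_closed [simp, intro]: "x \<in> carrier A \<Longrightarrow> c \<odot> x \<in> carrier A"
    and smult_l_distr: "x \<in> carrier A \<Longrightarrow> (c + d) \<odot> x = c \<odot> x \<oplus> d \<odot> x"
    and smult_r_distr: "x \<in> carrier A \<Longrightarrow> y \<in> carrier A \<Longrightarrow> c \<odot> (x \<oplus> y) = c \<odot> x \<oplus> c \<odot> y"
    and smult_smult [simp]: "x \<in> carrier A \<Longrightarrow> c \<odot> (d \<odot> x) = (c * d) \<odot> x"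
    and smult_one [simp]: "x \<in> carrier A \<Longrightarrow> 1 \<odot> x = x"
    and smult_mult_l [simp]: "x \<in> carrier A \<Longrightarrow> y \<in> carrier A \<Longrightarrow> (c \<odot> x) \<otimes> y = c \<odot> (x \<otimes> y)"
    and smult_mult_r [simp]: "x \<in> carrier A \<Longrightarrow> y \<in> carrier A \<Longrightarrow> x \<otimes> (c \<odot> y) = c \<odot> (x \<otimes> y)"

locale comm_scalar_algebra = scalar_algebra + cring A

context scalar_algebra
begin

lemma smult_zero_left [simp]: "x \<in> carrier A \<Longrightarrow> 0 \<odot> x = \<zero>"
  using smult_l_distr[of x 0 0] by (simp add: add.l_cancel_one')

lemma smult_zero_right [simp]: "c \<odot> \<zero> = \<zero>"
  using smult_smult[of \<zero> c 0] by simp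

lemma smult_minus_one: "x \<in> carrier A \<Longrightarrow> (- 1) \<odot> x = \<ominus> x"
  using smult_l_distr[of x "-1" 1] by (metis add.inv_equality add.left_inverse smult_closed smult_one smult_zero_left)

lemma smult_uminus: "x \<in> carrier A \<Longrightarrow> (- c) \<odot> x = \<ominus> (c \<odot> x)"
  using smult_minus_one[of "c \<odot> x"] by simp

lemma smult_cancel:
  assumes "x \<in> carrier A" "c + d = 0"
  shows "c \<odot> x \<oplus> d \<odot> x = \<zero>"
  using assms by (metis smult_l_distr smult_zero_left)

end

text \<open>
  A polynomial is only ever evaluated in the factored form \<open>(x - c\<^sub>1) \<cdots> (x - c\<^sub>m)\<close>, so the list of its
  roots stands for it. Subtraction is written with the scalar \<open>- c\<close>: unlike the negation of a
  record ring, this does not mention the carrier, so that the value is the same in every subalgebra.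
\<close>

definition linear_factor :: "('k::field, 'a, 'm) module_scheme \<Rightarrow> 'a \<Rightarrow> 'k \<Rightarrow> 'a" where
  "linear_factor A x c = x \<oplus>\<^bsub>A\<^esub> (- c) \<odot>\<^bsub>A\<^esub> \<one>\<^bsub>A\<^esub>"

definition root_prod :: "('k::field, 'a, 'm) module_scheme \<Rightarrow> 'a \<Rightarrow> 'k list \<Rightarrow> 'a" where
  "root_prod A x cs = foldr (\<lambda>c y. linear_factor A x c \<otimes>\<^bsub>A\<^esub> y) cs \<one>\<^bsub>A\<^esub>"

lemma root_prod_Nil [simp]: "root_prod A x [] = \<one>\<^bsub>A\<^esub>"
  and root_prod_Cons [simp]: "root_prod A x (c # cs) = linear_factor A x c \<otimes>\<^bsub>A\<^esub> root_prod A x cs"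
  by (simp_all add: root_prod_def)

context scalar_algebra
begin

lemma linear_factor_closed [simp, intro]: "x \<in> carrier A \<Longrightarrow> linear_factor A x c \<in> carrier A"
  by (simp add: linear_factor_def)

lemma root_prod_closed [simp, intro]: "x \<in> carrier A \<Longrightarrow> root_prod A x cs \<in> carrier A"
  by (induction cs) auto

lemma root_prod_append:
  "x \<in> carrier A \<Longrightarrow> root_prod A x (as @ bs) = root_prod A x as \<otimes> root_prod A x bs"
  by (induction as) (auto simp: m_assoc)

lemma linear_factor_shift:
  "x \<in> carrier A \<Longrightarrow> linear_factor A x b = linear_factor A x a \<oplus> (a - b) \<odot> \<one>"
  using smult_l_distr[of \<one> "-a" "a-b"] by (simp add: linear_factor_def a_assoc)

end

context comm_scalar_algebra
begin

text \<open>
  Adjoining the root \<open>b\<close> to the second factor: \<open>(x - b) - (x - a)\<close> is the invertible scalar \<open>a - b\<close>.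
\<close>

lemma linear_factor_root_prod_comaximal:
  assumes x: "x \<in> carrier A" and "a \<notin> set bs"
  shows "\<exists>u\<in>carrier A. \<exists>v\<in>carrier A.
           u \<otimes> linear_factor A x a \<oplus> v \<otimes> root_prod A x bs = \<one>"
  using assms(2)
proof (induction bs)
  case Nil
  show ?case
    by (intro bexI[of _ \<zero>] bexI[of _ \<one>]) (use x in auto)
next
  case (Cons b bs)
  let ?l = "linear_factor A x a" and ?p = "root_prod A x bs"
  from Cons obtain u v where uv: "u \<in> carrier A" "v \<in> carrier A" "u \<otimes> ?l \<oplus> v \<otimes> ?p = \<one>"
    by auto
  have ab: "a - b \<noteq> 0" using Cons.prems by auto
  define d where "d = inverse (a - b) \<odot> \<one>"
  define e where "e = (a - b) \<odot> \<one>"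
  have de: "d \<in> carrier A" "e \<in> carrier A" "d \<otimes> e = \<one>"
    using ab by (simp_all add: d_def e_def)
  have b: "linear_factor A x b = ?l \<oplus> e"
    unfolding e_def by (rule linear_factor_shift[OF x])
  have c: "?l \<in> carrier A" "?p \<in> carrier A" using x by auto
  have "(u \<ominus> d \<otimes> v \<otimes> ?p) \<otimes> ?l \<oplus> (d \<otimes> v) \<otimes> ((?l \<oplus> e) \<otimes> ?p)
        = u \<otimes> ?l \<oplus> (d \<otimes> e) \<otimes> (v \<otimes> ?p)"
    using uv(1,2) de(1,2) c by algebra
  also have "\<dots> = \<one>" using uv de c by simp
  finally show ?case
    using uv de c by (intro bexI[of _ "u \<ominus> d \<otimes> v \<otimes> ?p"] bexI[of _ "d \<otimes> v"]) (simp_all add: b)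
qed

text \<open>
  Bezout's identity for two polynomials without a common root.
\<close>

lemma root_prod_comaximal:
  assumes x: "x \<in> carrier A" and "set as \<inter> set bs = {}"
  shows "\<exists>u\<in>carrier A. \<exists>v\<in>carrier A. u \<otimes> root_prod A x as \<oplus> v \<otimes> root_prod A x bs = \<one>"
  using assms(2)
proof (induction as)
  case Nil
  show ?case
    by (intro bexI[of _ \<one>] bexI[of _ \<zero>]) (use x in auto)
next
  case (Cons a as)
  let ?l = "linear_factor A x a" and ?p = "root_prod A x as" and ?q = "root_prod A x bs"
  from Cons obtain u v where uv: "u \<in> carrier A" "v \<in> carrier A" "u \<otimes> ?p \<oplus> v \<otimes> ?q = \<one>"
    by auto
  from linear_factor_root_prod_comaximal[OF x, of a bs] Cons.prems
  obtain u' v' where uv': "u' \<in> carrier A" "v' \<in> carrier A" "u' \<otimes> ?l \<oplus> v' \<otimes> ?q = \<one>"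
    by auto
  have c: "?l \<in> carrier A" "?p \<in> carrier A" "?q \<in> carrier A" using x by auto
  have "(u' \<otimes> u) \<otimes> (?l \<otimes> ?p) \<oplus> (u' \<otimes> ?l \<otimes> v \<oplus> v' \<otimes> u \<otimes> ?p \<oplus> v' \<otimes> v \<otimes> ?q) \<otimes> ?q
     = (u' \<otimes> ?l \<oplus> v' \<otimes> ?q) \<otimes> (u \<otimes> ?p \<oplus> v \<otimes> ?q)"
    using uv(1,2) uv'(1,2) c by algebra
  also have "\<dots> = \<one>" using uv uv' by simp
  finally show ?case
    using uv uv' c by (intro bexI[of _ "u' \<otimes> u"] bexI[of _ "u' \<otimes> ?l \<otimes> v \<oplus> v' \<otimes> u \<otimes> ?p \<oplus> v' \<otimes> v \<otimes> ?q"])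
        simp_all
qed

text \<open>
  If every factor \<open>w a\<close> becomes a multiple of \<open>x - a\<close> once multiplied by \<open>m\<close>, then the product of the
  \<open>w a\<close> times \<open>m\<close> is a multiple of \<open>\<Prod>(x - a) = 0\<close>. This is how an annihilating polynomial of \<open>x\<close> is
  turned into one of an element related to \<open>x\<close>.
\<close>

lemma foldr_mult_eq_zero:
  assumes x: "x \<in> carrier A" "root_prod A x as = \<zero>" and m: "m \<in> carrier A"
    and w: "\<And>a. a \<in> set as \<Longrightarrow>
      w a \<in> carrier A \<and> (\<exists>q\<in>carrier A. w a \<otimes> m = linear_factor A x a \<otimes> q \<otimes> m)"
  shows "foldr (\<lambda>a y. w a \<otimes> y) as \<one> \<otimes> m = \<zero>"
proof -
  have "foldr (\<lambda>a y. w a \<otimes> y) as \<one> \<in> carrier A \<and>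
     (\<exists>q\<in>carrier A. foldr (\<lambda>a y. w a \<otimes> y) as \<one> \<otimes> m = root_prod A x as \<otimes> q \<otimes> m)"
    using w
  proof (induction as)
    case Nil
    then show ?case using m by (auto intro: bexI[of _ \<one>])
  next
    case (Cons a as)
    let ?F = "foldr (\<lambda>a y. w a \<otimes> y) as \<one>" and ?l = "linear_factor A x a"
      and ?p = "root_prod A x as"
    from Cons obtain q where q: "q \<in> carrier A" "?F \<otimes> m = ?p \<otimes> q \<otimes> m" and F: "?F \<in> carrier A"
      by auto
    from Cons.prems obtain r where r: "r \<in> carrier A" "w a \<otimes> m = ?l \<otimes> r \<otimes> m"
      and wa: "w a \<in> carrier A" by auto
    have c: "?l \<in> carrier A" "?p \<in> carrier A" using x by auto
    have "w a \<otimes> ?F \<otimes> m = w a \<otimes> (?F \<otimes> m)" using wa F m by (simp add: m_assoc)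
    also have "\<dots> = (w a \<otimes> m) \<otimes> (?p \<otimes> q)" using wa F m c q(1) unfolding q(2) by (simp add: m_ac)
    also have "\<dots> = ?l \<otimes> ?p \<otimes> (r \<otimes> q) \<otimes> m" using wa F m c q(1) r(1) unfolding r(2) by (simp add: m_ac)
    finally show ?case using F wa q r by auto
  qed
  then show ?thesis using x m by auto
qed

lemma root_prod_concat:
  "x \<in> carrier A \<Longrightarrow> root_prod A x (concat (map f as)) = foldr (\<lambda>a y. root_prod A x (f a) \<otimes> y) as \<one>"
  by (induction as) (auto simp: root_prod_append)

text \<open>
  The eigenvalues of a product of commuting elements are products of eigenvalues: since
  \<open>xy - ab = (x - a) y + a (y - b)\<close>, the product of the \<open>xy - ab\<close> over all roots \<open>b\<close> of \<open>y\<close> is a multiple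
  of \<open>x - a\<close>.
\<close>

lemma root_prod_mult:
  assumes x: "x \<in> carrier A" "root_prod A x as = \<zero>"
    and y: "y \<in> carrier A" "root_prod A y bs = \<zero>"
  shows "root_prod A (x \<otimes> y) (concat (map (\<lambda>a. map ((*) a) bs) as)) = \<zero>"
proof -
  have *: "\<exists>q\<in>carrier A. \<exists>r\<in>carrier A. root_prod A (x \<otimes> y) (map ((*) a) cs)
      = linear_factor A x a \<otimes> q \<oplus> r \<otimes> root_prod A y cs" for a cs
  proof (induction cs)
    case Nil
    show ?case by (intro bexI[of _ \<zero>] bexI[of _ \<one>]) (use x in auto)
  next
    case (Cons c cs)
    let ?l = "linear_factor A x a" and ?p = "root_prod A y cs" and ?m = "linear_factor A y c"
    from Cons obtain q r where qr: "q \<in> carrier A" "r \<in> carrier A"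
      "root_prod A (x \<otimes> y) (map ((*) a) cs) = ?l \<otimes> q \<oplus> r \<otimes> ?p" by auto
    define a' where "a' = a \<odot> \<one>"
    define c' where "c' = c \<odot> \<one>"
    have a': "a' \<in> carrier A" "c' \<in> carrier A" by (auto simp: a'_def c'_def)
    have l: "?l = x \<ominus> a'" "?m = y \<ominus> c'" "linear_factor A (x \<otimes> y) (a * c) = x \<otimes> y \<ominus> a' \<otimes> c'"
      by (simp_all add: linear_factor_def a'_def c'_def minus_eq mult.commute flip: smult_minus_one)
    have c: "?p \<in> carrier A" using y by auto
    have "linear_factor A (x \<otimes> y) (a * c) \<otimes> (?l \<otimes> q \<oplus> r \<otimes> ?p)
        = ?l \<otimes> (q \<otimes> (x \<otimes> y \<ominus> a' \<otimes> c') \<oplus> y \<otimes> r \<otimes> ?p) \<oplus> (a' \<otimes> r) \<otimes> (?m \<otimes> ?p)"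
      unfolding l using a' qr(1,2) c x(1) y(1) by algebra
    then show ?case using a' qr c x(1) y(1)
      by (intro bexI[of _ "q \<otimes> (x \<otimes> y \<ominus> a' \<otimes> c') \<oplus> y \<otimes> r \<otimes> ?p"] bexI[of _ "a' \<otimes> r"]) simp_all
  qed
  have "foldr (\<lambda>a z. root_prod A (x \<otimes> y) (map ((*) a) bs) \<otimes> z) as \<one> \<otimes> \<one> = \<zero>"
  proof (rule foldr_mult_eq_zero[OF x])
    fix a
    from *[of a bs] y show "root_prod A (x \<otimes> y) (map ((*) a) bs) \<in> carrier A \<and>
      (\<exists>q\<in>carrier A. root_prod A (x \<otimes> y) (map ((*) a) bs) \<otimes> \<one> = linear_factor A x a \<otimes> q \<otimes> \<one>)"
      using x by auto
  qed auto
  then show ?thesis using x y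
    by (subst root_prod_concat) (auto simp: root_prod_append[symmetric] simp flip: root_prod_concat)
qed

text \<open>
  The relation says \<open>(x - c y)(x - d y) = 0\<close> on the part where \<open>y\<close> does not already satisfy the polynomial
  of \<open>x\<close>; as \<open>c d = 1\<close>, an eigenvalue \<open>a\<close> of \<open>x\<close> then goes with the eigenvalues \<open>d a\<close> and \<open>c a\<close> of \<open>y\<close>.
  Formally, the relation minus \<open>(y - c a)(y - d a)\<close> is divisible by \<open>x - a\<close>.
\<close>

lemma root_prod_quadratic_relation:
  assumes x: "x \<in> carrier A" "root_prod A x as = \<zero>" and y: "y \<in> carrier A"
    and cd: "c * d = 1"
    and rel: "(x \<otimes> x \<oplus> y \<otimes> y \<oplus> (- (c + d)) \<odot> (x \<otimes> y)) \<otimes> root_prod A y as = \<zero>"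
  shows "root_prod A y (concat (map (\<lambda>a. [c * a, d * a]) as) @ as) = \<zero>"
proof -
  let ?m = "root_prod A y as"
  have m: "?m \<in> carrier A" using y by auto
  have "foldr (\<lambda>a z. root_prod A y [c * a, d * a] \<otimes> z) as \<one> \<otimes> ?m = \<zero>"
  proof (rule foldr_mult_eq_zero[OF x m])
    fix a
    let ?w = "root_prod A y [c * a, d * a]" and ?l = "linear_factor A x a"
    define a' where "a' = a \<odot> \<one>"
    define c' where "c' = c \<odot> \<one>"
    define d' where "d' = d \<odot> \<one>"
    have a': "a' \<in> carrier A" "c' \<in> carrier A" "d' \<in> carrier A" by (auto simp: a'_def c'_def d'_def)
    have l: "?l = x \<ominus> a'" "?w = (y \<ominus> c' \<otimes> a') \<otimes> (y \<ominus> d' \<otimes> a')"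
      using y by (simp_all add: linear_factor_def a'_def c'_def d'_def minus_eq mult.commute flip: smult_minus_one)
    have cd': "c' \<otimes> d' = \<one>" using cd by (simp add: c'_def d'_def mult.commute)
    \<comment> \<open>\<open>?h\<close> is the left factor of the relation, \<open>?w\<close> its value at \<open>x = a\<close>\<close>
    let ?t = "c' \<oplus> d'" and ?h = "x \<otimes> x \<oplus> y \<otimes> y \<oplus> (- (c + d)) \<odot> (x \<otimes> y)"
    have h: "?h = x \<otimes> x \<oplus> y \<otimes> y \<ominus> ?t \<otimes> (x \<otimes> y)"
      using x y smult_smult[of "x \<otimes> y" "-1" "c+d"]
      by (simp add: c'_def d'_def minus_eq l_distr smult_l_distr smult_minus_one)
    have "?w = y \<otimes> y \<ominus> ?t \<otimes> a' \<otimes> y \<oplus> (c' \<otimes> d') \<otimes> (a' \<otimes> a')"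
      unfolding l using a' x(1) y by algebra
    also have "\<dots> = ?l \<otimes> (?t \<otimes> y \<ominus> x \<ominus> a') \<oplus> ?h"
      unfolding cd' unfolding h l using a' x(1) y by algebra
    finally have w: "?w = ?l \<otimes> (?t \<otimes> y \<ominus> x \<ominus> a') \<oplus> ?h" .
    have "?w \<otimes> ?m = ?l \<otimes> (?t \<otimes> y \<ominus> x \<ominus> a') \<otimes> ?m \<oplus> ?h \<otimes> ?m"
      unfolding w using a' x(1) y m by (intro l_distr) auto
    also have "\<dots> = ?l \<otimes> (?t \<otimes> y \<ominus> x \<ominus> a') \<otimes> ?m"
      using rel a' x y m by simp
    finally show "?w \<in> carrier A \<and> (\<exists>q\<in>carrier A. ?w \<otimes> ?m = ?l \<otimes> q \<otimes> ?m)"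
      using a' x y by auto
  qed
  then show ?thesis
    using y by (simp add: root_prod_append root_prod_concat del: root_prod_Cons)
qed

end

definition commutant :: "('a, 'm) monoid_scheme \<Rightarrow> 'a set \<Rightarrow> 'a set" where
  "commutant A S = {x \<in> carrier A. \<forall>y\<in>S. x \<otimes>\<^bsub>A\<^esub> y = y \<otimes>\<^bsub>A\<^esub> x}"

context scalar_algebra
begin

lemma subring_commutant:
  assumes "S \<subseteq> carrier A"
  shows "subring (commutant A S) A"
proof (rule subringI)
  have S: "y \<in> S \<Longrightarrow> y \<in> carrier A" for y using assms by auto
  show "\<ominus> x \<in> commutant A S" if "x \<in> commutant A S" for x
    using that S by (auto simp: commutant_def l_minus r_minus)
  show "x \<otimes> y \<in> commutant A S" if "x \<in> commutant A S" "y \<in> commutant A S" for x y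
    using that S by (auto simp: commutant_def m_assoc) (metis m_assoc)
  show "x \<oplus> y \<in> commutant A S" if "x \<in> commutant A S" "y \<in> commutant A S" for x y
    using that S by (auto simp: commutant_def l_distr r_distr)
qed (use assms in \<open>auto simp: commutant_def\<close>)

lemma smult_in_commutant: "S \<subseteq> carrier A \<Longrightarrow> x \<in> commutant A S \<Longrightarrow> c \<odot> x \<in> commutant A S"
  by (auto simp: commutant_def subset_eq)

text \<open>
  The bicommutant of two commuting elements is a commutative subalgebra. It carries the
  statements about polynomials over to noncommutative algebras.
\<close>

lemma commuting_elements_in_comm_subalgebra:
  assumes "x \<in> carrier A" "y \<in> carrier A" "x \<otimes> y = y \<otimes> x"
  obtains B where "x \<in> B" "y \<in> B" "B \<subseteq> carrier A" "comm_scalar_algebra (A\<lparr>carrier := B\<rparr>)"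
proof
  define C where "C = commutant A {x, y}"
  define B where "B = commutant A C"
  have C: "C \<subseteq> carrier A" by (auto simp: C_def commutant_def)
  show B: "B \<subseteq> carrier A" by (auto simp: B_def commutant_def)
  show xy: "x \<in> B" "y \<in> B" using assms by (auto simp: B_def C_def commutant_def)
  have "x \<in> C" "y \<in> C" using assms by (auto simp: C_def commutant_def)
  then have BC: "B \<subseteq> C" using assms by (auto simp: B_def C_def commutant_def)
  have comm: "a \<otimes> b = b \<otimes> a" if "a \<in> B" "b \<in> B" for a b
    using that BC by (auto simp: B_def commutant_def)
  have sub: "subring B A" unfolding B_def by (rule subring_commutant[OF C])
  interpret B: ring "A\<lparr>carrier := B\<rparr>" by (rule subring_is_ring[OF sub])
  have smult: "a \<in> B \<Longrightarrow> c \<odot> a \<in> B" for a c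
    unfolding B_def by (rule smult_in_commutant[OF C])
  have BA: "a \<in> B \<Longrightarrow> a \<in> carrier A" for a using B by auto
  show "comm_scalar_algebra (A\<lparr>carrier := B\<rparr>)"
    by (intro comm_scalar_algebra.intro scalar_algebra.intro B.ring_axioms scalar_algebra_axioms.intro
          cring.intro comm_monoid.intro comm_monoid_axioms.intro B.is_monoid)
       (auto simp: smult comm BA smult_l_distr smult_r_distr)
qed

end

lemma root_prod_carrier_update [simp]: "root_prod (A\<lparr>carrier := B\<rparr>) x cs = root_prod A x cs"
  by (simp add: root_prod_def linear_factor_def cong: foldr_cong)

context scalar_algebra
begin

lemma comaximal_root_prods:
  assumes x: "x \<in> carrier A" and "set as \<inter> set bs = {}"
  obtains u v where "u \<in> carrier A" "v \<in> carrier A" "v \<otimes> root_prod A x bs = root_prod A x bs \<otimes> v"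
    "u \<otimes> root_prod A x as \<oplus> v \<otimes> root_prod A x bs = \<one>"
proof -
  from commuting_elements_in_comm_subalgebra[OF x x] obtain B where
    B: "x \<in> B" "B \<subseteq> carrier A" "comm_scalar_algebra (A\<lparr>carrier := B\<rparr>)" by metis
  interpret B: comm_scalar_algebra "A\<lparr>carrier := B\<rparr>" by fact
  from B.root_prod_comaximal[of x as bs] B assms(2) obtain u v where
    uv: "u \<in> B" "v \<in> B" "u \<otimes> root_prod A x as \<oplus> v \<otimes> root_prod A x bs = \<one>"
    by auto
  have "v \<otimes> root_prod A x bs = root_prod A x bs \<otimes> v"
    using B.m_comm[of v "root_prod A x bs"] B.root_prod_closed[of x bs] uv B(1) by simp
  with uv B that show ?thesis by auto
qed

lemma commuting_root_prod_mult:
  assumes "x \<in> carrier A" "root_prod A x as = \<zero>" "y \<in> carrier A" "root_prod A y bs = \<zero>"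
    and "x \<otimes> y = y \<otimes> x"
  shows "root_prod A (x \<otimes> y) (concat (map (\<lambda>a. map ((*) a) bs) as)) = \<zero>"
proof -
  from commuting_elements_in_comm_subalgebra[of x y] assms obtain B where
    B: "x \<in> B" "y \<in> B" "B \<subseteq> carrier A" "comm_scalar_algebra (A\<lparr>carrier := B\<rparr>)" by metis
  interpret B: comm_scalar_algebra "A\<lparr>carrier := B\<rparr>" by fact
  show ?thesis using B.root_prod_mult[of x as y bs] assms B by simp
qed

lemma commuting_root_prod_quadratic_relation:
  assumes "x \<in> carrier A" "root_prod A x as = \<zero>" "y \<in> carrier A"
    and "x \<otimes> y = y \<otimes> x" "c * d = 1"
    and "(x \<otimes> x \<oplus> y \<otimes> y \<oplus> (- (c + d)) \<odot> (x \<otimes> y)) \<otimes> root_prod A y as = \<zero>"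
  shows "root_prod A y (concat (map (\<lambda>a. [c * a, d * a]) as) @ as) = \<zero>"
proof -
  from commuting_elements_in_comm_subalgebra[of x y] assms obtain B where
    B: "x \<in> B" "y \<in> B" "B \<subseteq> carrier A" "comm_scalar_algebra (A\<lparr>carrier := B\<rparr>)" by metis
  interpret B: comm_scalar_algebra "A\<lparr>carrier := B\<rparr>" by fact
  show ?thesis using B.root_prod_quadratic_relation[of x as y c d] assms B by simp
qed

end

section \<open>The full twist and the hooks\<close>

text \<open>
  \<open>jucys_murphy A e m\<close> is the pure braid in which strand \<open>m + 1\<close> winds once around the strands
  \<open>1, \<dots>, m\<close>; it involves \<open>e\<^sub>1, \<dots>, e\<^sub>m\<close> only. The product of the first \<open>m\<close> of these is the full
  twist on \<open>m\<close> strands, which involves \<open>e\<^sub>1, \<dots>, e\<^bsub>m-1\<^esub>\<close> only. Both depend on the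
  multiplication but not on the carrier, and so mean the same in the free algebras of all sizes.
\<close>

primrec jucys_murphy :: "('a, 'm) monoid_scheme \<Rightarrow> (nat \<Rightarrow> 'a) \<Rightarrow> nat \<Rightarrow> 'a" where
  "jucys_murphy A e 0 = \<one>\<^bsub>A\<^esub>"
| "jucys_murphy A e (Suc m) = e (Suc m) \<otimes>\<^bsub>A\<^esub> jucys_murphy A e m \<otimes>\<^bsub>A\<^esub> e (Suc m)"

primrec full_twist :: "('a, 'm) monoid_scheme \<Rightarrow> (nat \<Rightarrow> 'a) \<Rightarrow> nat \<Rightarrow> 'a" where
  "full_twist A e 0 = \<one>\<^bsub>A\<^esub>"
| "full_twist A e (Suc m) = full_twist A e m \<otimes>\<^bsub>A\<^esub> jucys_murphy A e m"

lemma (in monoid) commute_mult: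
  assumes "x \<otimes> a = a \<otimes> x" "x \<otimes> b = b \<otimes> x" "x \<in> carrier G" "a \<in> carrier G" "b \<in> carrier G"
  shows "x \<otimes> (a \<otimes> b) = (a \<otimes> b) \<otimes> x"
  using assms by (metis m_assoc)

text \<open>
  Elements of an algebra that satisfy the defining relations, that is, a representation of
  the algebra \<open>K\<^sub>n\<close>. The Hecke algebra is the case in which the hooks vanish.
\<close>

locale bmw_relations = scalar_algebra A for A :: "('k::field, 'a, 'm) module_scheme" (structure) +
  fixes n :: nat and e e' h :: "nat \<Rightarrow> 'a" and \<alpha> s :: 'k
  assumes alpha_nonzero: "\<alpha> \<noteq> 0" and s_nonzero: "s \<noteq> 0" and s_generic: "s \<noteq> inverse s"
    and e_closed: "\<And>i. 1 \<le> i \<Longrightarrow> i < n \<Longrightarrow> e i \<in> carrier A"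
    and e'_closed: "\<And>i. 1 \<le> i \<Longrightarrow> i < n \<Longrightarrow> e' i \<in> carrier A"
    and h_closed: "\<And>i. 1 \<le> i \<Longrightarrow> i < n \<Longrightarrow> h i \<in> carrier A"
    and inv_right: "\<And>i. 1 \<le> i \<Longrightarrow> i < n \<Longrightarrow> e i \<otimes> e' i = \<one>"
    and inv_left: "\<And>i. 1 \<le> i \<Longrightarrow> i < n \<Longrightarrow> e' i \<otimes> e i = \<one>"
    and braid: "\<And>i. 1 \<le> i \<Longrightarrow> i + 1 < n \<Longrightarrow>
      e i \<otimes> e (i + 1) \<otimes> e i = e (i + 1) \<otimes> e i \<otimes> e (i + 1)"
    and far_comm: "\<And>i j. 1 \<le> i \<Longrightarrow> i < n \<Longrightarrow> 1 \<le> j \<Longrightarrow> j < n \<Longrightarrow> i + 2 \<le> j \<or> j + 2 \<le> i \<Longrightarrow>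
      e i \<otimes> e j = e j \<otimes> e i"
    and kink: "\<And>i. 1 \<le> i \<Longrightarrow> i < n \<Longrightarrow> h i \<otimes> e i = inverse \<alpha> \<odot> h i"
    and hook_pos: "\<And>i. 2 \<le> i \<Longrightarrow> i < n \<Longrightarrow> h i \<otimes> e (i - 1) \<otimes> h i = \<alpha> \<odot> h i"
    and hook_neg: "\<And>i. 2 \<le> i \<Longrightarrow> i < n \<Longrightarrow> h i \<otimes> e' (i - 1) \<otimes> h i = inverse \<alpha> \<odot> h i"
    and skein: "\<And>i. 1 \<le> i \<Longrightarrow> i < n \<Longrightarrow> e i \<ominus> e' i = (s - inverse s) \<odot> (\<one> \<ominus> h i)"
begin

abbreviation "L \<equiv> jucys_murphy A e"
abbreviation "T \<equiv> full_twist A e"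

lemma L_closed: "m = 0 \<or> m < n \<Longrightarrow> L m \<in> carrier A"
  by (induction m) (auto intro!: m_closed e_closed)

lemma T_closed: "m \<le> n \<Longrightarrow> T m \<in> carrier A"
  by (induction m) (auto intro!: m_closed L_closed)

lemma e_L_commute_above:
  "m + 2 \<le> i \<Longrightarrow> i < n \<Longrightarrow> e i \<otimes> L m = L m \<otimes> e i"
proof (induction m)
  case 0
  then show ?case by (simp add: e_closed)
next
  case (Suc m)
  then have "e i \<otimes> e (Suc m) = e (Suc m) \<otimes> e i" by (intro far_comm) auto
  with Suc show ?case
    by (simp, intro commute_mult) (auto intro!: e_closed L_closed m_closed)
qed

text \<open>
  A crossing inside the bundle of strands that strand \<open>m + 1\<close> encircles slides through the loop.
\<close>

lemma e_L_commute_below: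
  "1 \<le> i \<Longrightarrow> i < m \<Longrightarrow> m < n \<Longrightarrow> e i \<otimes> L m = L m \<otimes> e i"
proof (induction m)
  case 0
  then show ?case by simp
next
  case (Suc k)
  show ?case
  proof (cases "i < k")
    case True
    with Suc.prems have "e i \<otimes> e (Suc k) = e (Suc k) \<otimes> e i" by (intro far_comm) auto
    with Suc True show ?thesis
      by (simp, intro commute_mult) (auto intro!: e_closed L_closed m_closed)
  next
    case False
    with Suc.prems have "i = k" by simp
    with Suc.prems obtain j where j: "k = Suc j" "i = Suc j" by (cases k) auto
    define a b where "a = e i" and "b = e (Suc i)"
    have c: "a \<in> carrier A" "b \<in> carrier A" "L j \<in> carrier A"
      using Suc.prems j by (auto simp: a_def b_def intro: e_closed L_closed)
    have braid_ab: "a \<otimes> b \<otimes> a = b \<otimes> a \<otimes> b"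
      using braid[of i] Suc.prems j by (simp add: a_def b_def)
    have bL: "b \<otimes> L j = L j \<otimes> b"
      using e_L_commute_above[of j "Suc i"] Suc.prems j by (simp add: b_def)
    have L: "L (Suc k) = b \<otimes> (a \<otimes> L j \<otimes> a) \<otimes> b"
      by (simp add: j a_def b_def)
    have "a \<otimes> L (Suc k) = (a \<otimes> b \<otimes> a) \<otimes> L j \<otimes> a \<otimes> b"
      unfolding L using c by (simp add: m_assoc)
    also have "\<dots> = b \<otimes> a \<otimes> (b \<otimes> L j) \<otimes> a \<otimes> b"
      unfolding braid_ab using c by (simp add: m_assoc)
    also have "\<dots> = b \<otimes> a \<otimes> L j \<otimes> (b \<otimes> a \<otimes> b)"
      unfolding bL using c by (simp add: m_assoc)
    also have "\<dots> = L (Suc k) \<otimes> a"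
      unfolding braid_ab[symmetric] L using c by (simp add: m_assoc)
    finally show ?thesis by (simp add: a_def)
  qed
qed

lemma L_L_commute:
  assumes "j < m" "m < n"
  shows "L j \<otimes> L m = L m \<otimes> L j"
proof -
  have "L m \<otimes> L j = L j \<otimes> L m"
    using assms
  proof (induction j)
    case 0
    then show ?case by (simp add: L_closed)
  next
    case (Suc j)
    then have "L m \<otimes> e (Suc j) = e (Suc j) \<otimes> L m"
      using e_L_commute_below[of "Suc j" m] by simp
    with Suc show ?case
      by (simp, intro commute_mult) (auto intro!: e_closed L_closed m_closed)
  qed
  then show ?thesis by simp
qed

lemma T_L_commute:
  assumes "j \<le> m" "m < n"
  shows "L m \<otimes> T j = T j \<otimes> L m"
  using assms
proof (induction j)
  case 0
  then show ?case by (simp add: L_closed)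
next
  case (Suc j)
  then show ?case
    using L_L_commute[of j m] by (simp, intro commute_mult) (auto intro!: T_closed L_closed)
qed

lemma e_LL_commute:
  assumes "Suc m < n"
  shows "e (Suc m) \<otimes> (L m \<otimes> L (Suc m)) = L m \<otimes> L (Suc m) \<otimes> e (Suc m)"
proof -
  have c: "e (Suc m) \<in> carrier A" "L m \<in> carrier A"
    using assms by (auto intro: e_closed L_closed)
  have "L m \<otimes> (e (Suc m) \<otimes> L m \<otimes> e (Suc m)) = e (Suc m) \<otimes> L m \<otimes> e (Suc m) \<otimes> L m"
    using L_L_commute[of m "Suc m"] assms by simp
  with c show ?thesis by (simp add: m_assoc)
qed

lemma e_T_commute_above:
  "m < i \<Longrightarrow> i < n \<Longrightarrow> e i \<otimes> T m = T m \<otimes> e i"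
proof (induction m)
  case 0
  then show ?case by (simp add: e_closed)
next
  case (Suc m)
  then show ?case using e_L_commute_above[of m i]
    by (simp, intro commute_mult) (auto intro!: e_closed T_closed L_closed)
qed

text \<open>
  The full twist is central in the braid group: \<open>e\<^sub>i\<close> commutes with every Jucys--Murphy
  element except two consecutive ones, and it commutes with the product of these two.
\<close>

lemma e_T_commute:
  "1 \<le> i \<Longrightarrow> i < m \<Longrightarrow> m \<le> n \<Longrightarrow> e i \<otimes> T m = T m \<otimes> e i"
proof (induction m)
  case 0
  then show ?case by simp
next
  case (Suc m)
  show ?case
  proof (cases "i < m")
    case True
    with Suc e_L_commute_below[of i m] show ?thesis
      by (simp, intro commute_mult) (auto intro!: e_closed T_closed L_closed)
  next
    case False
    with Suc.prems have "i = m" by simp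
    with Suc.prems obtain j where j: "m = Suc j" "i = Suc j" by (cases m) auto
    have c: "e i \<in> carrier A" "T j \<in> carrier A" "L j \<in> carrier A" "L (Suc j) \<in> carrier A"
      using Suc.prems j by (auto intro!: e_closed T_closed L_closed simp del: jucys_murphy.simps)
    have "e i \<otimes> (T j \<otimes> (L j \<otimes> L (Suc j))) = T j \<otimes> (L j \<otimes> L (Suc j)) \<otimes> e i"
      using e_LL_commute[of j] e_T_commute_above[of j i] c Suc.prems j
      by (intro commute_mult[of _ "T j" "L j \<otimes> L (Suc j)"]) (simp_all del: jucys_murphy.simps)
    moreover have "T (Suc m) = T j \<otimes> (L j \<otimes> L (Suc j))"
      using c by (simp add: j m_assoc del: jucys_murphy.simps)
    ultimately show ?thesis by simp
  qed
qed

lemma intertwine_e':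
  assumes x: "x \<in> carrier A" and ij: "1 \<le> i" "i < n" "1 \<le> j" "j < n"
    and xe: "x \<otimes> e i = e j \<otimes> x"
  shows "x \<otimes> e' i = e' j \<otimes> x"
proof -
  note c = x e_closed[OF ij(1,2)] e_closed[OF ij(3,4)] e'_closed[OF ij(1,2)] e'_closed[OF ij(3,4)]
  have "x \<otimes> e' i = (e' j \<otimes> e j) \<otimes> x \<otimes> e' i"
    using c inv_left[OF ij(3,4)] by simp
  also have "\<dots> = e' j \<otimes> (e j \<otimes> x) \<otimes> e' i" using c by (simp add: m_assoc)
  also have "\<dots> = e' j \<otimes> x \<otimes> (e i \<otimes> e' i)" unfolding xe[symmetric] using c by (simp add: m_assoc)
  finally show ?thesis using c inv_right[OF ij(1,2)] by simp
qed

abbreviation "\<kappa> \<equiv> inverse (s - inverse s)"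

text \<open>
  The skein relation can be solved for the hook, because \<open>s - s\<^sup>-\<^sup>1 \<noteq> 0\<close>. So whatever intertwines crossings
  intertwines the hooks.
\<close>

lemma h_eq:
  assumes "1 \<le> i" "i < n"
  shows "h i = \<one> \<oplus> (- \<kappa>) \<odot> e i \<oplus> \<kappa> \<odot> e' i"
proof -
  note c = e_closed[OF assms] e'_closed[OF assms] h_closed[OF assms]
  have k: "\<kappa> * (s - inverse s) = 1" using s_generic by simp
  have "\<kappa> \<odot> (e i \<ominus> e' i) = \<one> \<ominus> h i"
    unfolding skein[OF assms] using c k by simp
  moreover have "\<kappa> \<odot> (e i \<ominus> e' i) = \<ominus> ((- \<kappa>) \<odot> e i \<oplus> \<kappa> \<odot> e' i)"
    using c smult_smult[of "e i" "-1" "-\<kappa>"] smult_smult[of "e' i" "-1" "\<kappa>"]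
      smult_smult[of "e' i" \<kappa> "-1"]
    by (simp add: minus_eq smult_r_distr minus_add flip: smult_minus_one)
  moreover have "h i = \<one> \<ominus> (\<one> \<ominus> h i)" using c by algebra
  ultimately have "h i = \<one> \<ominus> \<ominus> ((- \<kappa>) \<odot> e i \<oplus> \<kappa> \<odot> e' i)" by simp
  then show ?thesis using c by (simp add: minus_eq a_assoc)
qed

lemma intertwine_h:
  assumes x: "x \<in> carrier A" and ij: "1 \<le> i" "i < n" "1 \<le> j" "j < n"
    and xe: "x \<otimes> e i = e j \<otimes> x"
  shows "x \<otimes> h i = h j \<otimes> x"
  using x ij xe intertwine_e'[OF assms] e_closed[of i] e_closed[of j] e'_closed[of i] e'_closed[of j]
  by (simp add: h_eq l_distr r_distr)

lemma e_h: assumes "1 \<le> i" "i < n" shows "e i \<otimes> h i = inverse \<alpha> \<odot> h i"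
  using intertwine_h[of "e i" i i] kink[of i] assms e_closed[of i] by simp

lemma h_e':
  assumes i: "1 \<le> i" "i < n" shows "h i \<otimes> e' i = \<alpha> \<odot> h i"
proof -
  note c = e_closed[OF i] e'_closed[OF i] h_closed[OF i]
  have "h i \<otimes> e' i = \<alpha> \<odot> ((h i \<otimes> e i) \<otimes> e' i)"
    unfolding kink[OF i] using alpha_nonzero c by simp
  then show ?thesis using c inv_right[OF i] by (simp add: m_assoc)
qed

lemma e'_h: assumes "1 \<le> i" "i < n" shows "e' i \<otimes> h i = \<alpha> \<odot> h i"
  using intertwine_h[of "e' i" i i] h_e'[of i] assms e'_closed[of i] inv_left[of i] inv_right[of i] by simp

end

locale adjacent_hooks = bmw_relations +
  fixes i :: nat
  assumes i: "1 \<le> i" "Suc i < n"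
begin

abbreviation "a \<equiv> e i"
abbreviation "a' \<equiv> e' i"
abbreviation "b \<equiv> e (Suc i)"
abbreviation "b' \<equiv> e' (Suc i)"
abbreviation "hk1 \<equiv> h i"
abbreviation "hk2 \<equiv> h (Suc i)"

lemma closed [simp]: "a \<in> carrier A" "a' \<in> carrier A" "b \<in> carrier A" "b' \<in> carrier A"
  "hk1 \<in> carrier A" "hk2 \<in> carrier A"
  using i by (auto intro: e_closed e'_closed h_closed)

lemma braid_ab: "a \<otimes> b \<otimes> a = b \<otimes> a \<otimes> b"
  using braid[of i] i by simp

lemma ab_h: "a \<otimes> b \<otimes> hk1 = hk2 \<otimes> (a \<otimes> b)"
  by (rule intertwine_h) (use i braid_ab in \<open>simp_all add: m_assoc\<close>)

lemma ba_h: "b \<otimes> a \<otimes> hk2 = hk1 \<otimes> (b \<otimes> a)"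
  by (rule intertwine_h) (use i braid_ab in \<open>simp_all add: m_assoc\<close>)

lemma h_a_h: "hk2 \<otimes> a \<otimes> hk2 = \<alpha> \<odot> hk2" and h_a'_h: "hk2 \<otimes> a' \<otimes> hk2 = inverse \<alpha> \<odot> hk2"
  using hook_pos[of "Suc i"] hook_neg[of "Suc i"] i by simp_all

text \<open>
  The product of two adjacent hooks can be expressed by one hook and two crossings: conjugate
  \<open>h\<^sub>i\<close> to \<open>h\<^bsub>i+1\<^esub>\<close> by the braid relation, and absorb the remaining inverse
  crossings into the hooks, where the factors \<open>\<alpha>\<close> and \<open>\<alpha>\<^sup>-\<^sup>1\<close> cancel.
\<close>

lemma hook_hook_up: "hk2 \<otimes> hk1 = hk2 \<otimes> (a \<otimes> b)"
proof -
  have "hk2 \<otimes> hk1 = hk2 \<otimes> (b' \<otimes> (a' \<otimes> a) \<otimes> b) \<otimes> hk1"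
    using i by (simp add: inv_left)
  also have "\<dots> = (hk2 \<otimes> b') \<otimes> a' \<otimes> (a \<otimes> b \<otimes> hk1)"
    by (simp add: m_assoc)
  also have "\<dots> = \<alpha> \<odot> ((hk2 \<otimes> a' \<otimes> hk2) \<otimes> (a \<otimes> b))"
    using i unfolding ab_h by (simp add: h_e' m_assoc)
  also have "\<dots> = hk2 \<otimes> (a \<otimes> b)"
    unfolding h_a'_h using alpha_nonzero by simp
  finally show ?thesis .
qed

lemma hook_hook_down: "hk1 \<otimes> hk2 = hk1 \<otimes> (b \<otimes> a)"
proof -
  have "hk1 \<otimes> hk2 = hk1 \<otimes> (b \<otimes> (a \<otimes> a') \<otimes> b') \<otimes> hk2"
    using i by (simp add: inv_right)
  also have "\<dots> = (hk1 \<otimes> (b \<otimes> a)) \<otimes> a' \<otimes> (b' \<otimes> hk2)"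
    by (simp add: m_assoc)
  also have "\<dots> = \<alpha> \<odot> (b \<otimes> a \<otimes> (hk2 \<otimes> a' \<otimes> hk2))"
    using i unfolding ba_h[symmetric] by (simp add: e'_h m_assoc)
  also have "\<dots> = b \<otimes> a \<otimes> hk2"
    unfolding h_a'_h using alpha_nonzero by simp
  finally show ?thesis unfolding ba_h .
qed

text \<open>
  Straightening a bent strand. Expanding the middle hook by the skein relation gives the value of a
  circle corrected by two kinks, and these contributions cancel up to \<open>1\<close>.
\<close>

lemma hook_hook_hook: "hk2 \<otimes> hk1 \<otimes> hk2 = hk2"
proof -
  have "hk2 \<otimes> hk2 = hk2 \<otimes> (\<one> \<oplus> (- \<kappa>) \<odot> b \<oplus> \<kappa> \<odot> b')"
    using h_eq[of "Suc i"] i by simp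
  also have "\<dots> = hk2 \<oplus> (- \<kappa> * inverse \<alpha>) \<odot> hk2 \<oplus> (\<kappa> * \<alpha>) \<odot> hk2"
    using i by (simp add: r_distr kink h_e')
  finally have hh: "hk2 \<otimes> hk2 = hk2 \<oplus> (- \<kappa> * inverse \<alpha>) \<odot> hk2 \<oplus> (\<kappa> * \<alpha>) \<odot> hk2" .
  have "hk2 \<otimes> hk1 \<otimes> hk2 = hk2 \<otimes> (\<one> \<oplus> (- \<kappa>) \<odot> a \<oplus> \<kappa> \<odot> a') \<otimes> hk2"
    using h_eq[of i] i by simp
  also have "\<dots> = hk2 \<otimes> hk2 \<oplus> (- \<kappa>) \<odot> (hk2 \<otimes> a \<otimes> hk2) \<oplus> \<kappa> \<odot> (hk2 \<otimes> a' \<otimes> hk2)"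
    using i by (simp add: r_distr l_distr)
  also have "\<dots> = (1 + (- \<kappa> * inverse \<alpha>) + \<kappa> * \<alpha> + (- \<kappa>) * \<alpha> + \<kappa> * inverse \<alpha>) \<odot> hk2"
    unfolding h_a_h h_a'_h hh by (simp only: smult_l_distr closed smult_smult smult_one a_assoc smult_closed a_closed)
  also have "1 + (- \<kappa> * inverse \<alpha>) + \<kappa> * \<alpha> + (- \<kappa>) * \<alpha> + \<kappa> * inverse \<alpha> = 1" by simp
  finally show ?thesis by simp
qed

end

context bmw_relations
begin

text \<open>
  Adjacent hooks are conjugate, so the ideal of the last hook contains all hooks.
\<close>

lemma h_in_ideal_down:
  assumes i: "1 \<le> i" "Suc i < n"
  obtains x y where "x \<in> carrier A" "y \<in> carrier A" "h i = x \<otimes> h (Suc i) \<otimes> y"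
proof
  interpret adjacent_hooks A n e e' h \<alpha> s i by unfold_locales (use i in auto)
  show "b \<otimes> a \<in> carrier A" "a' \<otimes> b' \<in> carrier A" by auto
  have "h i = h i \<otimes> (b \<otimes> (a \<otimes> a') \<otimes> b')" using i by (simp add: inv_right)
  also have "\<dots> = h i \<otimes> (b \<otimes> a) \<otimes> (a' \<otimes> b')" by (simp add: m_assoc)
  finally show "h i = b \<otimes> a \<otimes> h (Suc i) \<otimes> (a' \<otimes> b')" unfolding ba_h .
qed

text \<open>
  Two parallel strands that are joined by a hook wind around the first \<open>m\<close> strands: the pair can be
  pulled off these strands, and only the kink factor of the hook remains.
\<close>

lemma L_e_L_h:
  "Suc m < n \<Longrightarrow> L m \<otimes> e (Suc m) \<otimes> L m \<otimes> h (Suc m) = inverse \<alpha> \<odot> h (Suc m)"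
proof (induction m)
  case 0
  then show ?case using e_h[of 1] e_closed[of 1] h_closed[of 1] by simp
next
  case (Suc m)
  interpret adjacent_hooks A n e e' h \<alpha> s "Suc m" by unfold_locales (use Suc.prems in auto)
  let ?L = "L m"
  have L: "?L \<in> carrier A" using Suc.prems by (auto intro: L_closed)
  have bL: "b \<otimes> ?L = ?L \<otimes> b" using e_L_commute_above[of m "Suc (Suc m)"] Suc.prems by simp
  have "L (Suc m) \<otimes> b \<otimes> L (Suc m) \<otimes> hk2 = a \<otimes> ?L \<otimes> (a \<otimes> b \<otimes> a) \<otimes> ?L \<otimes> a \<otimes> hk2"
    using L by (simp add: m_assoc)
  also have "\<dots> = a \<otimes> (?L \<otimes> b) \<otimes> a \<otimes> (b \<otimes> ?L) \<otimes> a \<otimes> hk2"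
    unfolding braid_ab using L by (simp add: m_assoc)
  also have "\<dots> = a \<otimes> (b \<otimes> ?L) \<otimes> a \<otimes> (?L \<otimes> b) \<otimes> a \<otimes> hk2"
    unfolding bL ..
  also have "\<dots> = a \<otimes> b \<otimes> ?L \<otimes> a \<otimes> ?L \<otimes> (b \<otimes> a \<otimes> hk2)"
    using L by (simp add: m_assoc)
  also have "\<dots> = a \<otimes> b \<otimes> (?L \<otimes> a \<otimes> ?L \<otimes> hk1) \<otimes> (b \<otimes> a)"
    unfolding ba_h using L by (simp add: m_assoc)
  also have "\<dots> = inverse \<alpha> \<odot> ((a \<otimes> b \<otimes> hk1) \<otimes> (b \<otimes> a))"
    using Suc by simp
  also have "(a \<otimes> b \<otimes> hk1) \<otimes> (b \<otimes> a) = hk2 \<otimes> (hk1 \<otimes> (b \<otimes> a))"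
    unfolding ab_h hook_hook_up[symmetric] by (simp add: m_assoc)
  also have "\<dots> = hk2"
    using hook_hook_hook by (simp add: hook_hook_down[symmetric] m_assoc)
  finally show ?case .
qed

text \<open>
  Pulling a hook through the full twist: the last two strands come off the others, at the cost of two
  kinks, and leave the full twist on two strands less. This is why the full twist has different
  eigenvalues on the hook ideal and on the quotient by it.
\<close>

lemma T_h:
  assumes "Suc m < n"
  shows "T (Suc (Suc m)) \<otimes> h (Suc m) = (inverse \<alpha> * inverse \<alpha>) \<odot> (T m \<otimes> h (Suc m))"
proof -
  let ?e = "e (Suc m)" and ?h = "h (Suc m)"
  have c: "?e \<in> carrier A" "?h \<in> carrier A" "L m \<in> carrier A" "T m \<in> carrier A"
    using assms by (auto intro: e_closed h_closed L_closed T_closed)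
  have "T (Suc (Suc m)) \<otimes> ?h = T m \<otimes> (L m \<otimes> ?e \<otimes> L m \<otimes> (?e \<otimes> ?h))"
    using c by (simp add: m_assoc)
  also have "?e \<otimes> ?h = inverse \<alpha> \<odot> ?h" using assms by (simp add: e_h)
  also have "T m \<otimes> (L m \<otimes> ?e \<otimes> L m \<otimes> (inverse \<alpha> \<odot> ?h))
      = inverse \<alpha> \<odot> (T m \<otimes> (L m \<otimes> ?e \<otimes> L m \<otimes> ?h))" using c by simp
  finally show ?thesis using c L_e_L_h[OF assms] by simp
qed

end

section \<open>Eigenvalues of the full twist in the Hecke algebra\<close>

text \<open>
  The eigenvalues of the Jucys--Murphy elements and of the full twist in the Hecke algebra have this
  form.
\<close>

definition even_powers :: "'k::field \<Rightarrow> 'k set" where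
  "even_powers s = {s powi (2 * j) | j. True}"

lemma one_in_even_powers: "1 \<in> even_powers s"
  by (auto simp: even_powers_def intro!: exI[of _ 0])

lemma mult_in_even_powers:
  assumes "s \<noteq> 0" "a \<in> even_powers s" "b \<in> even_powers s"
  shows "a * b \<in> even_powers s"
proof -
  from assms obtain i j where "a = s powi (2 * i)" "b = s powi (2 * j)" by (auto simp: even_powers_def)
  then have "a * b = s powi (2 * (i + j))" using assms(1) by (simp add: power_int_add distrib_left)
  then show ?thesis unfolding even_powers_def by blast
qed

lemma square_in_even_powers: "s * s \<in> even_powers s" "inverse s * inverse s \<in> even_powers s"
proof -
  have "s * s = s powi (2 * 1)" by (simp add: power2_eq_square)
  moreover have "inverse s * inverse s = s powi (2 * -1)" by (simp add: power_int_minus power2_eq_square)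
  ultimately show "s * s \<in> even_powers s" "inverse s * inverse s \<in> even_powers s"
    unfolding even_powers_def by blast+
qed

context scalar_algebra
begin

lemma intertwine_root_prod:
  assumes "x \<in> carrier A" "y \<in> carrier A" "f \<in> carrier A" "f \<otimes> x = y \<otimes> f"
  shows "f \<otimes> root_prod A x cs = root_prod A y cs \<otimes> f"
proof (induction cs)
  case (Cons c cs)
  have "f \<otimes> linear_factor A x c = linear_factor A y c \<otimes> f"
    using assms by (simp add: linear_factor_def l_distr r_distr)
  then have "f \<otimes> (linear_factor A x c \<otimes> root_prod A x cs) = linear_factor A y c \<otimes> (f \<otimes> root_prod A x cs)"
    using assms by (simp add: m_assoc[symmetric])
  then show ?case unfolding Cons.IH using assms by (simp add: m_assoc)
qed (use assms in simp)

lemma root_prod_one_one: "root_prod A \<one> [1] = \<zero>"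
  using smult_cancel[of \<one> 1 "-1"] by (simp add: linear_factor_def)

end

locale hecke_relations = bmw_relations +
  assumes h_zero: "\<And>i. 1 \<le> i \<Longrightarrow> i < n \<Longrightarrow> h i = \<zero>"
begin

text \<open>
  The intertwining element of the affine Hecke algebra of rank two. In the Hecke algebra \<open>e - e'\<close> is
  the scalar \<open>z = s - s\<^sup>-\<^sup>1\<close>, and \<open>e X = Y e'\<close>, \<open>X e = e' Y\<close>. The commutator of \<open>e\<close> and \<open>X\<close> therefore
  interchanges \<open>X\<close> and \<open>Y\<close>, and its square is \<open>- (X - s\<^sup>2 Y)(X - s\<^sup>-\<^sup>2 Y)\<close>.
\<close>

lemma intertwiner:
  assumes i: "1 \<le> i" "i < n" and X: "X \<in> carrier A" and Y: "Y = e i \<otimes> X \<otimes> e i"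
    and XY: "X \<otimes> Y = Y \<otimes> X"
  defines "f \<equiv> e i \<otimes> X \<ominus> X \<otimes> e i"
  shows "f \<otimes> X = Y \<otimes> f"
    and "f \<otimes> f = (s * s + inverse s * inverse s) \<odot> (X \<otimes> Y) \<ominus> (X \<otimes> X \<oplus> Y \<otimes> Y)"
proof -
  define g g' where "g = e i" and "g' = e' i"
  define z where "z = (s - inverse s) \<odot> \<one>"
  have c: "g \<in> carrier A" "g' \<in> carrier A" "z \<in> carrier A" "Y \<in> carrier A"
    using i X by (auto simp: g_def g'_def z_def Y intro!: e_closed e'_closed m_closed)
  have f: "f = g \<otimes> X \<ominus> X \<otimes> g" by (simp add: f_def g_def)
  have gg': "g \<otimes> g' = \<one>" "g' \<otimes> g = \<one>" using i by (auto simp: g_def g'_def inv_left inv_right)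
  have z: "z \<otimes> w = w \<otimes> z" if "w \<in> carrier A" for w using that by (simp add: z_def)
  have gz: "g \<ominus> g' = z" using skein[OF i] i by (simp add: g_def g'_def z_def h_zero minus_eq)
  have "g' = g \<ominus> (g \<ominus> g')" using c by algebra
  then have g': "g' = g \<ominus> z" unfolding gz .
  have gX: "g \<otimes> X = Y \<otimes> g'" using c X gg' by (simp add: Y m_assoc g_def[symmetric])
  have Xg: "X \<otimes> g = g' \<otimes> Y"
    using c X gg' by (simp add: Y m_assoc[symmetric] g_def[symmetric])
  have "f \<otimes> X = (Y \<otimes> (g \<ominus> z) \<ominus> X \<otimes> g) \<otimes> X" by (simp add: f gX g')
  also have "\<dots> = Y \<otimes> (g \<otimes> X) \<ominus> X \<otimes> (g \<otimes> X) \<ominus> Y \<otimes> (z \<otimes> X)" using c X by algebra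
  also have "\<dots> = Y \<otimes> (g \<otimes> X) \<ominus> X \<otimes> (Y \<otimes> (g \<ominus> z)) \<ominus> Y \<otimes> (X \<otimes> z)"
    unfolding z[OF X] by (simp add: gX flip: g')
  also have "\<dots> = Y \<otimes> (g \<otimes> X) \<ominus> (X \<otimes> Y) \<otimes> (g \<ominus> z) \<ominus> (Y \<otimes> X) \<otimes> z" using c X by algebra
  also have "\<dots> = Y \<otimes> (g \<otimes> X) \<ominus> (Y \<otimes> X) \<otimes> g" unfolding XY using c X by algebra
  also have "\<dots> = Y \<otimes> f" unfolding f using c X by algebra
  finally show "f \<otimes> X = Y \<otimes> f" .
  have eXY: "(X \<otimes> Y) \<otimes> g = g \<otimes> (X \<otimes> Y)"
    using XY c X by (simp add: Y m_assoc g_def[symmetric])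
  have gg: "g \<otimes> g = \<one> \<oplus> z \<otimes> g"
  proof -
    have "g \<otimes> g = g \<otimes> (g \<ominus> z) \<oplus> g \<otimes> z" using c by algebra
    then show ?thesis using gg' z[OF c(1)] by (simp flip: g')
  qed
  have g'g': "g' \<otimes> g' = \<one> \<ominus> z \<otimes> g'"
  proof -
    have "g' \<otimes> g' = g' \<otimes> (g \<ominus> z)" by (simp flip: g')
    also have "\<dots> = g' \<otimes> g \<ominus> g' \<otimes> z" using c by algebra
    finally show ?thesis using gg' z[OF c(2)] by simp
  qed
  have 1: "(g \<otimes> X) \<otimes> (g \<otimes> X) = X \<otimes> Y" using c X by (simp add: XY) (simp add: Y m_assoc g_def)
  have 2: "(X \<otimes> g) \<otimes> (X \<otimes> g) = X \<otimes> Y" using c X by (simp add: Y m_assoc g_def)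
  have 3: "(g \<otimes> X) \<otimes> (X \<otimes> g) = Y \<otimes> Y \<ominus> z \<otimes> (g \<otimes> (X \<otimes> Y))"
  proof -
    have "(g \<otimes> X) \<otimes> (X \<otimes> g) = Y \<otimes> (g' \<otimes> g') \<otimes> Y" unfolding gX Xg using c by (simp add: m_assoc)
    also have "\<dots> = Y \<otimes> Y \<ominus> (Y \<otimes> z) \<otimes> g' \<otimes> Y" unfolding g'g' using c by algebra
    also have "\<dots> = Y \<otimes> Y \<ominus> z \<otimes> (Y \<otimes> g') \<otimes> Y" unfolding z[OF c(4), symmetric] using c by algebra
    also have "\<dots> = Y \<otimes> Y \<ominus> z \<otimes> (g \<otimes> (X \<otimes> Y))" unfolding gX[symmetric] using c X by algebra
    finally show ?thesis .
  qed
  have 4: "(X \<otimes> g) \<otimes> (g \<otimes> X) = X \<otimes> X \<oplus> z \<otimes> (g' \<otimes> (X \<otimes> Y))"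
  proof -
    have "(X \<otimes> g) \<otimes> (g \<otimes> X) = X \<otimes> (g \<otimes> g) \<otimes> X" using c X by (simp add: m_assoc)
    also have "\<dots> = X \<otimes> X \<oplus> (X \<otimes> z) \<otimes> g \<otimes> X" unfolding gg using c X by algebra
    also have "\<dots> = X \<otimes> X \<oplus> z \<otimes> (X \<otimes> g) \<otimes> X" unfolding z[OF X, symmetric] using c X by algebra
    also have "\<dots> = X \<otimes> X \<oplus> z \<otimes> (g' \<otimes> (X \<otimes> Y))" unfolding Xg XY using c X by algebra
    finally show ?thesis .
  qed
  have "f \<otimes> f = (g \<otimes> X) \<otimes> (g \<otimes> X) \<oplus> (X \<otimes> g) \<otimes> (X \<otimes> g) \<ominus> (g \<otimes> X) \<otimes> (X \<otimes> g) \<ominus> (X \<otimes> g) \<otimes> (g \<otimes> X)"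
    unfolding f using c X by algebra
  also have "\<dots> = (X \<otimes> Y) \<oplus> (X \<otimes> Y) \<oplus> z \<otimes> (g \<ominus> (g \<ominus> z)) \<otimes> (X \<otimes> Y) \<ominus> (X \<otimes> X \<oplus> Y \<otimes> Y)"
    unfolding 1 2 3 4 unfolding g' using c X by algebra
  also have "g \<ominus> (g \<ominus> z) = z" using c by algebra
  also have "(X \<otimes> Y) \<oplus> (X \<otimes> Y) \<oplus> z \<otimes> z \<otimes> (X \<otimes> Y) = (1 + 1 + (s - inverse s) * (s - inverse s)) \<odot> (X \<otimes> Y)"
    using c X by (simp only: smult_l_distr m_closed smult_one) (simp add: z_def)
  also have "1 + 1 + (s - inverse s) * (s - inverse s) = s * s + inverse s * inverse s"
    using s_nonzero by (simp add: algebra_simps)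
  finally show "f \<otimes> f = (s * s + inverse s * inverse s) \<odot> (X \<otimes> Y) \<ominus> (X \<otimes> X \<oplus> Y \<otimes> Y)" .
qed

text \<open>
  Let \<open>p(X) = 0\<close> for a Jucys--Murphy element \<open>X\<close>, and let \<open>Y = e X e\<close> be the next one. The intertwiner
  \<open>f\<close> gives \<open>p(Y) f = f p(X) = 0\<close>, hence \<open>p(Y) f\<^sup>2 = 0\<close>. So \<open>Y\<close> has only the eigenvalues of \<open>X\<close> and
  these multiplied by \<open>s\<^sup>2\<close> or \<open>s\<^sup>-\<^sup>2\<close>.
\<close>

lemma L_annihilated:
  "m < n \<Longrightarrow> \<exists>cs. set cs \<subseteq> even_powers s \<and> root_prod A (L m) cs = \<zero>"
proof (induction m)
  case 0
  show ?case
    by (intro exI[of _ "[1]"]) (auto simp: one_in_even_powers root_prod_one_one simp del: root_prod_Cons)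
next
  case (Suc m)
  let ?X = "L m" and ?Y = "L (Suc m)"
  from Suc obtain cs where cs: "set cs \<subseteq> even_powers s" "root_prod A ?X cs = \<zero>" by auto
  have c: "?X \<in> carrier A" "?Y \<in> carrier A" "e (Suc m) \<in> carrier A"
    using Suc.prems by (auto intro!: L_closed e_closed m_closed)
  have XY: "?X \<otimes> ?Y = ?Y \<otimes> ?X" using L_L_commute[of m "Suc m"] Suc.prems by simp
  define f where "f = e (Suc m) \<otimes> ?X \<ominus> ?X \<otimes> e (Suc m)"
  define t where "t = s * s + inverse s * inverse s"
  have f: "f \<in> carrier A" using c by (simp add: f_def)
  have fX: "f \<otimes> ?X = ?Y \<otimes> f" and ff: "f \<otimes> f = t \<odot> (?X \<otimes> ?Y) \<ominus> (?X \<otimes> ?X \<oplus> ?Y \<otimes> ?Y)"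
    using intertwiner[of "Suc m" ?X ?Y] XY c Suc.prems unfolding f_def t_def by simp_all
  let ?p = "root_prod A ?Y cs" and ?h = "?X \<otimes> ?X \<oplus> ?Y \<otimes> ?Y \<oplus> (- t) \<odot> (?X \<otimes> ?Y)"
  have p: "?p \<in> carrier A" using c by blast
  have h: "?h \<in> carrier A" using c by blast
  have hp: "?h \<otimes> ?p = ?p \<otimes> ?h"
  proof (rule intertwine_root_prod)
    show "?h \<otimes> ?Y = ?Y \<otimes> ?h"
      using c(1,2) XY by (simp add: l_distr r_distr m_assoc del: jucys_murphy.simps)
        (simp add: m_assoc[symmetric] del: jucys_murphy.simps)
  qed (use c h in auto)
  have "?p \<otimes> f = \<zero>"
    using intertwine_root_prod[OF c(1,2) f fX, of cs] cs f by simp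
  then have "(?p \<otimes> f) \<otimes> f = \<zero>" using f by simp
  moreover have "?h = \<ominus> (f \<otimes> f)"
    using c by (simp add: ff minus_eq minus_add a_ac smult_uminus del: jucys_murphy.simps)
  ultimately have "?p \<otimes> ?h = \<zero>" using p f by (simp add: r_minus m_assoc)
  with hp have "?h \<otimes> ?p = \<zero>" by simp
  moreover have "(s * s) * (inverse s * inverse s) = 1" using s_nonzero by (simp add: field_simps)
  ultimately have "root_prod A ?Y (concat (map (\<lambda>a. [(s * s) * a, (inverse s * inverse s) * a]) cs) @ cs) = \<zero>"
    using c cs XY by (intro commuting_root_prod_quadratic_relation[of ?X]) (auto simp: t_def)
  moreover have "set (concat (map (\<lambda>a. [(s * s) * a, (inverse s * inverse s) * a]) cs) @ cs) \<subseteq> even_powers s"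
    using cs(1) mult_in_even_powers[OF s_nonzero square_in_even_powers(1)]
      mult_in_even_powers[OF s_nonzero square_in_even_powers(2)] by auto
  ultimately show ?case by blast
qed

lemma T_annihilated:
  "m \<le> n \<Longrightarrow> \<exists>cs. set cs \<subseteq> even_powers s \<and> root_prod A (T m) cs = \<zero>"
proof (induction m)
  case 0
  show ?case
    by (intro exI[of _ "[1]"]) (auto simp: one_in_even_powers root_prod_one_one simp del: root_prod_Cons)
next
  case (Suc m)
  then obtain as where as: "set as \<subseteq> even_powers s" "root_prod A (T m) as = \<zero>" by auto
  from L_annihilated[of m] Suc.prems
  obtain bs where bs: "set bs \<subseteq> even_powers s" "root_prod A (L m) bs = \<zero>" by auto
  have "root_prod A (T m \<otimes> L m) (concat (map (\<lambda>a. map ((*) a) bs) as)) = \<zero>"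
    using as bs Suc.prems T_L_commute[of m m]
    by (intro commuting_root_prod_mult) (auto intro!: T_closed L_closed)
  moreover have "set (concat (map (\<lambda>a. map ((*) a) bs) as)) \<subseteq> even_powers s"
    using as(1) bs(1) mult_in_even_powers[OF s_nonzero] by auto
  ultimately show ?case by (auto simp del: set_concat)
qed

end

section \<open>Homomorphisms, quotients, and ideals with a unit element\<close>

locale scalar_algebra_hom = A: scalar_algebra A + B: scalar_algebra B
  for A :: "('k::field, 'a, 'm) module_scheme" and B :: "('k, 'b, 'l) module_scheme" +
  fixes f :: "'a \<Rightarrow> 'b"
  assumes f_closed [simp, intro]: "x \<in> carrier A \<Longrightarrow> f x \<in> carrier B"
    and f_add: "x \<in> carrier A \<Longrightarrow> y \<in> carrier A \<Longrightarrow> f (x \<oplus>\<^bsub>A\<^esub> y) = f x \<oplus>\<^bsub>B\<^esub> f y"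
    and f_mult: "x \<in> carrier A \<Longrightarrow> y \<in> carrier A \<Longrightarrow> f (x \<otimes>\<^bsub>A\<^esub> y) = f x \<otimes>\<^bsub>B\<^esub> f y"
    and f_smult: "x \<in> carrier A \<Longrightarrow> f (c \<odot>\<^bsub>A\<^esub> x) = c \<odot>\<^bsub>B\<^esub> f x"
    and f_one [simp]: "f \<one>\<^bsub>A\<^esub> = \<one>\<^bsub>B\<^esub>"
begin

lemma f_zero [simp]: "f \<zero>\<^bsub>A\<^esub> = \<zero>\<^bsub>B\<^esub>"
  using f_smult[of "\<one>\<^bsub>A\<^esub>" 0] by simp

lemma f_minus: "x \<in> carrier A \<Longrightarrow> y \<in> carrier A \<Longrightarrow> f (x \<ominus>\<^bsub>A\<^esub> y) = f x \<ominus>\<^bsub>B\<^esub> f y"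
  using f_smult[of y "-1"] by (simp add: a_minus_def f_add A.smult_minus_one B.smult_minus_one)

lemma f_root_prod: "x \<in> carrier A \<Longrightarrow> f (root_prod A x cs) = root_prod B (f x) cs"
  by (induction cs) (simp_all add: f_mult f_add f_smult linear_factor_def A.root_prod_closed)

lemma f_jucys_murphy:
  assumes "\<And>i. 1 \<le> i \<Longrightarrow> i \<le> m \<Longrightarrow> e i \<in> carrier A"
  shows "jucys_murphy A e m \<in> carrier A \<and> f (jucys_murphy A e m) = jucys_murphy B (\<lambda>i. f (e i)) m"
  using assms by (induction m) (auto simp: f_mult)

lemma f_full_twist:
  assumes "\<And>i. 1 \<le> i \<Longrightarrow> i < m \<Longrightarrow> e i \<in> carrier A"
  shows "full_twist A e m \<in> carrier A \<and> f (full_twist A e m) = full_twist B (\<lambda>i. f (e i)) m"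
  using assms
proof (induction m)
  case (Suc m)
  have "jucys_murphy A e m \<in> carrier A \<and> f (jucys_murphy A e m) = jucys_murphy B (\<lambda>i. f (e i)) m"
    by (rule f_jucys_murphy) (use Suc.prems in auto)
  with Suc show ?case by (simp add: f_mult)
qed auto

text \<open>
  The relations pass to quotients, in particular to the Hecke algebra.
\<close>

lemma bmw_relations_image:
  assumes "bmw_relations A n e e' h \<alpha> s"
  shows "bmw_relations B n (\<lambda>i. f (e i)) (\<lambda>i. f (e' i)) (\<lambda>i. f (h i)) \<alpha> s"
proof -
  interpret R: bmw_relations A n e e' h \<alpha> s by fact
  have f_mult3: "f (x \<otimes>\<^bsub>A\<^esub> y \<otimes>\<^bsub>A\<^esub> w) = f x \<otimes>\<^bsub>B\<^esub> f y \<otimes>\<^bsub>B\<^esub> f w"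
    if "x \<in> carrier A" "y \<in> carrier A" "w \<in> carrier A" for x y w
    using that by (simp add: f_mult)
  show ?thesis
  proof
    show "\<alpha> \<noteq> 0" "s \<noteq> 0" "s \<noteq> inverse s" by (rule R.alpha_nonzero R.s_nonzero R.s_generic)+
  next
    fix i assume i: "1 \<le> i" "i + 1 < n"
    have "e i \<in> carrier A" "e (i + 1) \<in> carrier A" using i by (auto intro: R.e_closed)
    with arg_cong[OF R.braid[OF i], of f]
    show "f (e i) \<otimes>\<^bsub>B\<^esub> f (e (i + 1)) \<otimes>\<^bsub>B\<^esub> f (e i) = f (e (i + 1)) \<otimes>\<^bsub>B\<^esub> f (e i) \<otimes>\<^bsub>B\<^esub> f (e (i + 1))"
      by (simp only: f_mult3)
  next
    fix i j assume ij: "1 \<le> i" "i < n" "1 \<le> j" "j < n" "i + 2 \<le> j \<or> j + 2 \<le> i"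
    show "f (e i) \<otimes>\<^bsub>B\<^esub> f (e j) = f (e j) \<otimes>\<^bsub>B\<^esub> f (e i)"
      using arg_cong[OF R.far_comm[OF ij], of f] R.e_closed[OF ij(1,2)] R.e_closed[OF ij(3,4)]
      by (simp only: f_mult)
  next
    fix i assume i: "2 \<le> i" "i < n"
    have c: "e (i - 1) \<in> carrier A" "e' (i - 1) \<in> carrier A" "h i \<in> carrier A"
      using i by (auto intro: R.e_closed R.e'_closed R.h_closed)
    show "f (h i) \<otimes>\<^bsub>B\<^esub> f (e (i - 1)) \<otimes>\<^bsub>B\<^esub> f (h i) = \<alpha> \<odot>\<^bsub>B\<^esub> f (h i)"
      using arg_cong[OF R.hook_pos[OF i], of f] c by (simp only: f_mult3 f_smult)
    show "f (h i) \<otimes>\<^bsub>B\<^esub> f (e' (i - 1)) \<otimes>\<^bsub>B\<^esub> f (h i) = inverse \<alpha> \<odot>\<^bsub>B\<^esub> f (h i)"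
      using arg_cong[OF R.hook_neg[OF i], of f] c by (simp only: f_mult3 f_smult)
  next
    fix i assume i: "1 \<le> i" "i < n"
    note c = R.e_closed[OF i] R.e'_closed[OF i] R.h_closed[OF i]
    show "f (e i) \<in> carrier B" "f (e' i) \<in> carrier B" "f (h i) \<in> carrier B"
      using c by auto
    show "f (e i) \<otimes>\<^bsub>B\<^esub> f (e' i) = \<one>\<^bsub>B\<^esub>"
      using arg_cong[OF R.inv_right[OF i], of f] c by (simp only: f_mult f_one)
    show "f (e' i) \<otimes>\<^bsub>B\<^esub> f (e i) = \<one>\<^bsub>B\<^esub>"
      using arg_cong[OF R.inv_left[OF i], of f] c by (simp only: f_mult f_one)
    show "f (h i) \<otimes>\<^bsub>B\<^esub> f (e i) = inverse \<alpha> \<odot>\<^bsub>B\<^esub> f (h i)"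
      using arg_cong[OF R.kink[OF i], of f] c by (simp only: f_mult f_smult)
    show "f (e i) \<ominus>\<^bsub>B\<^esub> f (e' i) = (s - inverse s) \<odot>\<^bsub>B\<^esub> (\<one>\<^bsub>B\<^esub> \<ominus>\<^bsub>B\<^esub> f (h i))"
      using arg_cong[OF R.skein[OF i], of f] c
      by (simp only: f_minus f_smult f_one A.one_closed A.minus_closed)
  qed
qed

end

locale algebra_ideal = scalar_algebra A + ideal I A
  for A :: "('k::field, 'a, 'm) module_scheme" (structure) and I
begin

abbreviation "Q \<equiv> quotient_algebra A I"
abbreviation "q \<equiv> \<lambda>x. I +> x"

lemma smult_in_ideal: "x \<in> I \<Longrightarrow> c \<odot> x \<in> I"
  using I_l_closed[of x "c \<odot> \<one>"] by (simp add: Icarr)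

lemma q_eq_iff: "x \<in> carrier A \<Longrightarrow> y \<in> carrier A \<Longrightarrow> q x = q y \<longleftrightarrow> x \<ominus> y \<in> I"
  using quotient_eq_iff_same_a_r_cos[OF ideal_axioms] by simp

lemma Q_simps:
  "carrier Q = q ` carrier A" "one Q = q \<one>" "zero Q = I"
  "mult Q = rcoset_mult A I" "add Q = set_add A" "smult Q = (\<lambda>c X. \<Union>x\<in>X. q (c \<odot> x))"
  by (auto simp: quotient_algebra_def ring.extend_def module.fields_def FactRing_def A_RCOSETS_def'
      ring.defs module.defs monoid.defs)

lemma q_smult: "x \<in> carrier A \<Longrightarrow> c \<odot>\<^bsub>Q\<^esub> q x = q (c \<odot> x)"
proof -
  assume x: "x \<in> carrier A"
  have "q (c \<odot> y) = q (c \<odot> x)" if "y \<in> q x" for y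
  proof -
    from that obtain i where i: "i \<in> I" "y = i \<oplus> x" by (auto simp: a_r_coset_def')
    then have ic: "i \<in> carrier A" by (simp add: Icarr)
    have "c \<odot> y = c \<odot> i \<oplus> c \<odot> x" unfolding i(2) by (rule smult_r_distr[OF ic x])
    moreover have "(c \<odot> i \<oplus> c \<odot> x) \<ominus> c \<odot> x = c \<odot> i"
      using smult_closed[OF ic, of c] smult_closed[OF x, of c] by algebra
    moreover have "c \<odot> y \<in> carrier A" unfolding i(2) using ic x by blast
    ultimately show ?thesis
      using smult_in_ideal[OF i(1), of c] x by (simp add: q_eq_iff)
  qed
  moreover have "x \<in> q x" using x by (rule a_rcos_self)
  ultimately have "(\<Union>y\<in>q x. q (c \<odot> y)) = q (c \<odot> x)" by blast
  then show ?thesis by (simp only: Q_simps)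
qed

lemma q_mult: "x \<in> carrier A \<Longrightarrow> y \<in> carrier A \<Longrightarrow> q x \<otimes>\<^bsub>Q\<^esub> q y = q (x \<otimes> y)"
  by (simp add: Q_simps rcoset_mult_add)

lemma q_add: "x \<in> carrier A \<Longrightarrow> y \<in> carrier A \<Longrightarrow> q x \<oplus>\<^bsub>Q\<^esub> q y = q (x \<oplus> y)"
  by (simp add: Q_simps a_rcos_sum)

lemma q_eq_zero_iff: "x \<in> carrier A \<Longrightarrow> q x = \<zero>\<^bsub>Q\<^esub> \<longleftrightarrow> x \<in> I"
  using a_rcos_zero[OF ideal_axioms] rcos_const_imp_mem by (auto simp: Q_simps)

lemma Q_ring: "ring Q"
proof -
  interpret QR: ring "A Quot I" by (rule quotient_is_ring)
  have eq: "carrier Q = carrier (A Quot I)" "one Q = one (A Quot I)" "zero Q = zero (A Quot I)"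
    "mult Q = mult (A Quot I)" "add Q = add (A Quot I)"
    by (simp_all add: quotient_algebra_def ring.defs module.defs)
  show ?thesis
  proof (rule ringI)
    show "abelian_group Q"
    proof (rule abelian_groupI)
      fix X assume X: "X \<in> carrier Q"
      show "\<exists>Y\<in>carrier Q. Y \<oplus>\<^bsub>Q\<^esub> X = \<zero>\<^bsub>Q\<^esub>"
        using X QR.l_neg[of X] QR.a_inv_closed[of X] unfolding eq by blast
    qed (simp_all add: eq QR.a_ac)
    show "Group.monoid Q"
      by (rule monoidI) (simp_all add: eq QR.m_assoc)
  qed (simp_all add: eq QR.l_distr QR.r_distr)
qed

lemma Q_scalar_algebra: "scalar_algebra Q"
proof (intro scalar_algebra.intro Q_ring scalar_algebra_axioms.intro)
qed (auto simp: Q_simps(1) q_smult q_add q_mult smult_l_distr smult_r_distr)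

lemma q_hom: "scalar_algebra_hom A Q q"
  by (intro scalar_algebra_hom.intro scalar_algebra_hom_axioms.intro scalar_algebra_axioms Q_scalar_algebra)
     (auto simp: Q_simps(1,2) q_smult q_add q_mult)

end

lemma (in ring) minus_eq_zeroD:
  assumes "x \<in> carrier R" "y \<in> carrier R" "x \<ominus> y = \<zero>"
  shows "x = y"
proof -
  have "x = (x \<ominus> y) \<oplus> y" using assms(1,2) by algebra
  then show ?thesis using assms by simp
qed

context algebra_ideal begin
text \<open>
  The conditions on \<open>z\<close> make \<open>1 - z\<close> a unit element of the ideal \<open>I\<close>. The class of \<open>x\<close> is lifted to
  \<open>z x\<close>, which depends on the class only since \<open>z I = 0\<close>. Conversely, a section \<open>\<sigma>\<close> whose values kill \<open>I\<close> has
  \<open>\<sigma> X = \<sigma> X z\<close>; two such sections differ at \<open>X\<close> by an element of \<open>I\<close>, which \<open>z\<close> kills.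
\<close>

theorem unique_section_annihilating_ideal:
  assumes z: "z \<in> carrier A" "\<one> \<ominus> z \<in> I"
    and zI: "\<And>y. y \<in> I \<Longrightarrow> z \<otimes> y = \<zero>" and Iz: "\<And>y. y \<in> I \<Longrightarrow> y \<otimes> z = \<zero>"
  shows "\<exists>!\<sigma>. \<sigma> \<in> extensional (carrier Q) \<and> multiplicative_hom Q A \<sigma> \<and>
           (\<forall>x\<in>carrier Q. q (\<sigma> x) = x) \<and>
           (\<forall>x\<in>carrier Q. \<forall>y\<in>I. \<sigma> x \<otimes> y = \<zero> \<and> y \<otimes> \<sigma> x = \<zero>)"
proof (rule ex_ex1I)
  define \<sigma> where "\<sigma> = (\<lambda>X\<in>carrier Q. z \<otimes> (SOME x. x \<in> carrier A \<and> X = q x))"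
  have z_cong: "z \<otimes> x = z \<otimes> y" if "x \<in> carrier A" "y \<in> carrier A" "q x = q y" for x y
  proof -
    have "z \<otimes> (x \<ominus> y) = \<zero>" using that by (simp add: q_eq_iff zI)
    moreover have "z \<otimes> (x \<ominus> y) = z \<otimes> x \<ominus> z \<otimes> y" using that(1,2) z(1) by algebra
    ultimately show ?thesis using that(1,2) z(1) by - (rule minus_eq_zeroD; simp)
  qed
  have \<sigma>: "\<sigma> (q x) = z \<otimes> x" if x: "x \<in> carrier A" for x
  proof -
    let ?y = "SOME y. y \<in> carrier A \<and> q x = q y"
    have y: "?y \<in> carrier A \<and> q x = q ?y" by (rule someI[of _ x]) (use x in simp)
    have "\<sigma> (q x) = z \<otimes> ?y" using x by (simp add: \<sigma>_def Q_simps(1))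
    also have "\<dots> = z \<otimes> x"
      by (rule z_cong[OF conjunct1[OF y] x conjunct2[OF y, symmetric]])
    finally show ?thesis .
  qed
  have qz: "q z = q \<one>"
    using z q_eq_iff[of \<one> z] by simp
  have zxz: "z \<otimes> (x \<otimes> (z \<otimes> y)) = z \<otimes> (x \<otimes> y)" if xy: "x \<in> carrier A" "y \<in> carrier A" for x y
  proof (rule z_cong)
    have "q (x \<otimes> (z \<otimes> y)) = q x \<otimes>\<^bsub>Q\<^esub> (q \<one> \<otimes>\<^bsub>Q\<^esub> q y)"
      unfolding qz[symmetric] using xy z(1) by (simp add: q_mult)
    also have "\<dots> = q (x \<otimes> y)" using xy by (simp add: q_mult)
    finally show "q (x \<otimes> (z \<otimes> y)) = q (x \<otimes> y)" .
  qed (use xy z in auto)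
  have q_z_mult: "q (z \<otimes> x) = q x" if "x \<in> carrier A" for x
  proof -
    have "q (z \<otimes> x) = q \<one> \<otimes>\<^bsub>Q\<^esub> q x" unfolding qz[symmetric] using that z(1) by (simp add: q_mult)
    then show ?thesis using that by (simp add: q_mult)
  qed
  have "\<sigma> \<in> extensional (carrier Q)" by (simp add: \<sigma>_def)
  moreover have "multiplicative_hom Q A \<sigma>"
    unfolding multiplicative_hom_def Q_simps(1)
    using z(1) zxz by (auto simp: \<sigma> q_add q_mult q_smult r_distr m_assoc)
  moreover have "\<forall>x\<in>carrier Q. q (\<sigma> x) = x"
    by (auto simp: Q_simps(1) \<sigma> q_z_mult)
  moreover have "\<forall>x\<in>carrier Q. \<forall>y\<in>I. \<sigma> x \<otimes> y = \<zero> \<and> y \<otimes> \<sigma> x = \<zero>"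
  proof (intro ballI)
    fix X y assume "X \<in> carrier Q" and y: "y \<in> I"
    then obtain x where x: "x \<in> carrier A" "X = q x" by (auto simp: Q_simps(1))
    have yc: "y \<in> carrier A" using y by (rule Icarr)
    have "z \<otimes> x \<otimes> y = z \<otimes> (x \<otimes> y)" using x yc z(1) by (simp add: m_assoc)
    moreover have "y \<otimes> (z \<otimes> x) = (y \<otimes> z) \<otimes> x" using x yc z(1) by (simp add: m_assoc)
    ultimately show "\<sigma> X \<otimes> y = \<zero> \<and> y \<otimes> \<sigma> X = \<zero>"
      using zI[OF I_l_closed[OF y x(1)]] Iz[OF y] x by (simp add: \<sigma>)
  qed
  ultimately show "\<exists>\<sigma>. \<sigma> \<in> extensional (carrier Q) \<and> multiplicative_hom Q A \<sigma> \<and>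
           (\<forall>x\<in>carrier Q. q (\<sigma> x) = x) \<and>
           (\<forall>x\<in>carrier Q. \<forall>y\<in>I. \<sigma> x \<otimes> y = \<zero> \<and> y \<otimes> \<sigma> x = \<zero>)"
    by blast
next
  fix \<sigma> \<tau>
  let ?P = "\<lambda>\<sigma>. \<sigma> \<in> extensional (carrier Q) \<and> multiplicative_hom Q A \<sigma> \<and>
           (\<forall>x\<in>carrier Q. q (\<sigma> x) = x) \<and>
           (\<forall>x\<in>carrier Q. \<forall>y\<in>I. \<sigma> x \<otimes> y = \<zero> \<and> y \<otimes> \<sigma> x = \<zero>)"
  assume P: "?P \<sigma>" "?P \<tau>"
  show "\<sigma> = \<tau>"
  proof (rule extensionalityI[of _ "carrier Q"])
    fix X assume X: "X \<in> carrier Q"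
    have c: "\<rho> X \<in> carrier A" if "?P \<rho>" for \<rho>
      using that X by (auto simp: multiplicative_hom_def)
    have fix_z: "\<rho> X \<otimes> z = \<rho> X" if "?P \<rho>" for \<rho>
    proof -
      have "\<rho> X \<otimes> (\<one> \<ominus> z) = \<zero>" using that X z by blast
      moreover have "\<rho> X \<otimes> (\<one> \<ominus> w) = \<rho> X \<ominus> \<rho> X \<otimes> w" if "w \<in> carrier A" for w
        using c[OF \<open>?P \<rho>\<close>] that by (simp add: minus_eq r_distr r_minus)
      ultimately have "\<rho> X \<ominus> \<rho> X \<otimes> z = \<zero>" using z(1) by simp
      then show ?thesis using c[OF that] z(1) by - (rule minus_eq_zeroD[symmetric]; simp)
    qed
    have "q (\<sigma> X) = q (\<tau> X)" using P X by simp
    then have "\<sigma> X \<ominus> \<tau> X \<in> I" using c[OF P(1)] c[OF P(2)] by (simp add: q_eq_iff)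
    then have "(\<sigma> X \<ominus> \<tau> X) \<otimes> z = \<zero>" by (rule Iz)
    moreover have "(\<sigma> X \<ominus> \<tau> X) \<otimes> z = \<sigma> X \<otimes> z \<ominus> \<tau> X \<otimes> z"
      using c[OF P(1)] c[OF P(2)] z(1) by (simp add: minus_eq l_distr l_minus)
    ultimately have "\<sigma> X \<otimes> z = \<tau> X \<otimes> z" using c[OF P(1)] c[OF P(2)] z(1) by - (rule minus_eq_zeroD; simp)
    then show "\<sigma> X = \<tau> X" by (simp add: fix_z P)
  qed (use P in auto)
qed

end

lemma (in ring) ideal_annihilator_of_central:
  assumes g: "g \<in> carrier R" "\<And>x. x \<in> carrier R \<Longrightarrow> g \<otimes> x = x \<otimes> g"
  shows "ideal {x \<in> carrier R. g \<otimes> x = \<zero>} R"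
proof (rule idealI)
  show "subgroup {x \<in> carrier R. g \<otimes> x = \<zero>} (add_monoid R)"
  proof (rule add.subgroupI)
    show "\<ominus> x \<in> {x \<in> carrier R. g \<otimes> x = \<zero>}"
      if "x \<in> {x \<in> carrier R. g \<otimes> x = \<zero>}" for x
      using that g(1) by (simp add: r_minus)
    show "x \<oplus> y \<in> {x \<in> carrier R. g \<otimes> x = \<zero>}"
      if "x \<in> {x \<in> carrier R. g \<otimes> x = \<zero>}" "y \<in> {x \<in> carrier R. g \<otimes> x = \<zero>}" for x y
      using that g(1) by (simp add: r_distr)
  next
    have "\<zero> \<in> {x \<in> carrier R. g \<otimes> x = \<zero>}" using g(1) by simp
    then show "{x \<in> carrier R. g \<otimes> x = \<zero>} \<noteq> {}" by blast
  qed auto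
next
  fix x y assume x: "x \<in> {x \<in> carrier R. g \<otimes> x = \<zero>}" and y: "y \<in> carrier R"
  have xc: "x \<in> carrier R" "g \<otimes> x = \<zero>" using x by auto
  have "g \<otimes> (x \<otimes> y) = (g \<otimes> x) \<otimes> y" using xc(1) y g(1) by (simp add: m_assoc)
  then show "x \<otimes> y \<in> {x \<in> carrier R. g \<otimes> x = \<zero>}"
    using xc y by simp
  have "g \<otimes> (y \<otimes> x) = (y \<otimes> g) \<otimes> x" unfolding g(2)[OF y, symmetric] using xc(1) y g(1) by (simp add: m_assoc)
  also have "\<dots> = y \<otimes> (g \<otimes> x)" using xc(1) y g(1) by (simp add: m_assoc)
  finally show "y \<otimes> x \<in> {x \<in> carrier R. g \<otimes> x = \<zero>}"
    using xc y by simp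
qed (rule ring_axioms)

section \<open>Free algebras\<close>

lemma free_algebra_simps [simp]:
  "mult (free_algebra G) = (*)" "one (free_algebra G) = 1" "zero (free_algebra G) = 0"
  "add (free_algebra G) = (+)" "smult (free_algebra G) = (\<lambda>c f. Poly_Mapping.single 0 c * f)"
  by (simp_all add: free_algebra_def)

lemma carrier_free_algebra:
  "f \<in> carrier (free_algebra G) \<longleftrightarrow> (\<forall>w\<in>Poly_Mapping.keys f. set (letters w) \<subseteq> G)"
  by (simp add: free_algebra_def)

lemma letters_plus [simp]: "letters (v + w) = letters v @ letters w"
  and letters_zero [simp]: "letters 0 = []"
  by (simp_all add: plus_word_def zero_word_def)

lemma single_in_free_algebra:
  "set (letters w) \<subseteq> G \<Longrightarrow> Poly_Mapping.single w c \<in> carrier (free_algebra G)"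
  by (simp add: carrier_free_algebra)

lemma update_eq_single_add:
  "a \<notin> Poly_Mapping.keys f \<Longrightarrow> Poly_Mapping.update a b f = Poly_Mapping.single a b + f"
  by (rule poly_mapping_eqI)
     (auto simp: lookup_update lookup_add lookup_single when_def in_keys_iff)

text \<open>
  The scalars are central although the monoid of words is not commutative.
\<close>

lemma single_0_commute:
  fixes f :: "'g word \<Rightarrow>\<^sub>0 'k::comm_ring_1"
  shows "f * Poly_Mapping.single 0 c = Poly_Mapping.single 0 c * f"
proof (induction f rule: update_induct)
  case const
  show ?case by simp
next
  case (update f a b)
  then show ?case
    by (simp add: update_eq_single_add distrib_left distrib_right mult_single mult.commute)
qed

lemma free_algebra_mult_closed:
  assumes "f \<in> carrier (free_algebra G)" "g \<in> carrier (free_algebra G)"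
  shows "f * g \<in> carrier (free_algebra G)"
  using assms keys_mult[of f g] by (fastforce simp: carrier_free_algebra)

lemma free_algebra_add_closed:
  assumes "f \<in> carrier (free_algebra G)" "g \<in> carrier (free_algebra G)"
  shows "f + g \<in> carrier (free_algebra G)"
  using assms Poly_Mapping.keys_add[of f g] by (auto simp: carrier_free_algebra)

lemma free_algebra_induct [consumes 1, case_names scalar gen add mult]:
  fixes f :: "'g word \<Rightarrow>\<^sub>0 'k::comm_ring_1"
  assumes "f \<in> carrier (free_algebra G)"
    and scalar: "\<And>c. P (Poly_Mapping.single 0 c)"
    and gen: "\<And>g. g \<in> G \<Longrightarrow> P (Poly_Mapping.single (Word [g]) 1)"
    and add: "\<And>f g. f \<in> carrier (free_algebra G) \<Longrightarrow> g \<in> carrier (free_algebra G) \<Longrightarrow>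
      P f \<Longrightarrow> P g \<Longrightarrow> P (f + g)"
    and mult: "\<And>f g. f \<in> carrier (free_algebra G) \<Longrightarrow> g \<in> carrier (free_algebra G) \<Longrightarrow>
      P f \<Longrightarrow> P g \<Longrightarrow> P (f * g)"
  shows "P f"
proof -
  have monomial: "P (Poly_Mapping.single (Word w) c)" if "set w \<subseteq> G" for w c
    using that
  proof (induction w)
    case Nil
    show ?case using scalar by (simp add: zero_word_def)
  next
    case (Cons g w)
    have "Poly_Mapping.single (Word (g # w)) c
        = Poly_Mapping.single (Word [g]) 1 * Poly_Mapping.single (Word w) c"
      by (simp add: mult_single plus_word_def)
    moreover have "P (Poly_Mapping.single (Word [g]) 1 * Poly_Mapping.single (Word w) c)"
      using Cons by (intro mult gen single_in_free_algebra) auto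
    ultimately show ?case by simp
  qed
  show ?thesis
    using assms(1)
  proof (induction f rule: update_induct)
    case const
    show ?case using scalar[of 0] by simp
  next
    case (update f a b)
    have f: "f \<in> carrier (free_algebra G)" and a: "set (letters a) \<subseteq> G"
      using update.prems update.hyps by (auto simp: carrier_free_algebra keys_update)
    have "P (Poly_Mapping.single (Word (letters a)) b + f)"
      using f a by (intro add single_in_free_algebra monomial update.IH) auto
    then show ?case using update.hyps by (simp add: update_eq_single_add)
  qed
qed

lemma scalar_algebra_free_algebra:
  "scalar_algebra (free_algebra G :: ('k::field, 'g word \<Rightarrow>\<^sub>0 'k) module)" (is "scalar_algebra ?F")
proof (intro scalar_algebra.intro scalar_algebra_axioms.intro)
  show "ring ?F"
  proof (rule ringI)
    show "abelian_group ?F"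
    proof (rule abelian_groupI)
      fix x assume "x \<in> carrier ?F"
      then show "\<exists>y\<in>carrier ?F. y \<oplus>\<^bsub>?F\<^esub> x = \<zero>\<^bsub>?F\<^esub>"
        by (intro bexI[of _ "- x"]) (auto simp: carrier_free_algebra)
    qed (auto simp: free_algebra_add_closed add_ac, simp add: carrier_free_algebra)
    show "Group.monoid ?F"
      by (rule monoidI) (auto simp: free_algebra_mult_closed mult.assoc, simp add: carrier_free_algebra)
  qed (simp_all add: distrib_left distrib_right)
next
  fix x :: "'g word \<Rightarrow>\<^sub>0 'k" and c :: 'k assume "x \<in> carrier ?F"
  then show "c \<odot>\<^bsub>?F\<^esub> x \<in> carrier ?F"
    by (simp add: free_algebra_mult_closed single_in_free_algebra)
next
  fix x y :: "'g word \<Rightarrow>\<^sub>0 'k" and c :: 'k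
  have "x * (Poly_Mapping.single 0 c * y) = (x * Poly_Mapping.single 0 c) * y" by (simp only: mult.assoc)
  then show "x \<otimes>\<^bsub>?F\<^esub> (c \<odot>\<^bsub>?F\<^esub> y) = c \<odot>\<^bsub>?F\<^esub> (x \<otimes>\<^bsub>?F\<^esub> y)"
    by (simp add: single_0_commute mult.assoc)
qed (simp_all add: distrib_left distrib_right single_add mult_single flip: mult.assoc)

lemma free_algebra_minus:
  assumes "x \<in> carrier (free_algebra G)" "y \<in> carrier (free_algebra G :: ('k::field, 'g word \<Rightarrow>\<^sub>0 'k) module)"
  shows "x \<ominus>\<^bsub>free_algebra G\<^esub> y = x - y"
proof -
  interpret scalar_algebra "free_algebra G :: ('k, 'g word \<Rightarrow>\<^sub>0 'k) module"
    by (rule scalar_algebra_free_algebra)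
  have "Poly_Mapping.single 0 (- 1) * y = - y"
    by (simp add: single_uminus)
  then show ?thesis using smult_minus_one[OF assms(2)] by (simp add: a_minus_def)
qed

section \<open>Eigenvalues of the full twist on the hook ideal\<close>

lemma Fract_power: "Fract p 1 ^ m = Fract (p ^ m) (1 :: 'a::idom)"
  by (induction m) (simp_all add: One_fract_def)

text \<open>
  Compare the degrees in \<open>\<alpha>\<close>, which is the outer variable, and then the degrees in \<open>s\<close>.
\<close>

lemma k_alpha_k_s_independent:
  assumes "k_alpha ^ a * k_s ^ b = k_s ^ c"
  shows "a = 0 \<and> b = c"
proof -
  let ?S = "[:[:0, 1:]:] :: rat poly poly" and ?A = "[:0, 1:] :: rat poly poly"
  from assms have eq: "?A ^ a * ?S ^ b = ?S ^ c"
    by (simp add: k_alpha_def k_s_def Fract_power eq_fract)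
  have S: "?S ^ m = [:[:0, 1:] ^ m:]" for m
    by (induction m) (simp_all add: one_pCons)
  have "degree (?A ^ a * ?S ^ b) = a"
    unfolding S by (simp add: degree_mult_eq degree_power_eq)
  moreover have "degree (?S ^ c) = 0" unfolding S by simp
  ultimately have a: "a = 0" using eq by simp
  with eq have "[:0, 1 :: rat:] ^ b = [:0, 1:] ^ c" by (simp add: S)
  then have "degree ([:0, 1 :: rat:] ^ b) = degree ([:0, 1 :: rat:] ^ c)" by simp
  then show ?thesis using a by (simp add: degree_power_eq)
qed

lemma k_s_nonzero: "k_s \<noteq> 0" and k_alpha_nonzero: "k_alpha \<noteq> 0"
  by (simp_all add: k_s_def k_alpha_def Zero_fract_def eq_fract)

lemma k_s_neq_inverse: "k_s \<noteq> inverse k_s"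
proof
  assume "k_s = inverse k_s"
  then have "k_s * k_s = 1" using k_s_nonzero by (metis right_inverse)
  then show False using k_alpha_k_s_independent[of 0 2 0] by (simp add: power2_eq_square)
qed

text \<open>
  The eigenvalues of the full twist on the layer of \<open>K\<^sub>n\<close> with \<open>k\<close> hooks have the form
  \<open>\<alpha>\<^bsup>-2k\<^esup> s\<^bsup>2j\<^esup>\<close>.
\<close>

definition twist_roots :: "'k::field \<Rightarrow> 'k \<Rightarrow> 'k set" where
  "twist_roots \<alpha> s = {inverse \<alpha> ^ (2 * k) * x | k x. x \<in> even_powers s}"

lemma even_powers_subset_twist_roots: "even_powers s \<subseteq> twist_roots \<alpha> s"
  unfolding twist_roots_def by (force intro: exI[of _ 0])

lemma shift_in_twist_roots:
  "x \<in> twist_roots \<alpha> s \<Longrightarrow> (inverse \<alpha> * inverse \<alpha>) * x \<in> twist_roots \<alpha> s"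
proof -
  assume "x \<in> twist_roots \<alpha> s"
  then obtain k y where "y \<in> even_powers s" "x = inverse \<alpha> ^ (2 * k) * y" by (auto simp: twist_roots_def)
  moreover from this have "(inverse \<alpha> * inverse \<alpha>) * x = inverse \<alpha> ^ (2 * Suc k) * y" by simp
  ultimately show ?thesis unfolding twist_roots_def by blast
qed

text \<open>
  An eigenvalue without hooks differs from every eigenvalue with at least one hook: equality would
  make a positive power of \<open>\<alpha>\<close> a power of \<open>s\<close>.
\<close>

lemma even_powers_disjoint_shifted_roots:
  assumes "x \<in> even_powers k_s" "y \<in> twist_roots k_alpha k_s"
  shows "x \<noteq> (inverse k_alpha * inverse k_alpha) * y"
proof
  assume eq: "x = (inverse k_alpha * inverse k_alpha) * y"
  from assms obtain i j :: int and k where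
    x: "x = k_s powi (2 * i)" and y: "y = inverse k_alpha ^ (2 * k) * k_s powi (2 * j)"
    by (auto simp: twist_roots_def even_powers_def)
  \<comment> \<open>multiplication by \<open>s\<^bsup>N\<^esup>\<close> makes all exponents of \<open>s\<close> nonnegative\<close>
  define N where "N = 2 * \<bar>i\<bar> + 2 * \<bar>j\<bar>"
  have up: "k_s powi N * k_s powi (2 * l) = k_s ^ nat (N + 2 * l)" if "N + 2 * l \<ge> 0" for l
    using that k_s_nonzero by (simp add: power_int_add[symmetric]) (simp add: power_int_def)
  have "0 \<le> N + 2 * i" "0 \<le> N + 2 * j" by (simp_all add: N_def)
  note up = up[OF this(1)] up[OF this(2)]
  have "k_alpha ^ (2 * k + 2) * x = k_s powi (2 * j)"
    unfolding eq y using k_alpha_nonzero by (simp add: power_add power2_eq_square field_simps)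
  then have "k_alpha ^ (2 * k + 2) * (k_s powi N * x) = k_s powi N * k_s powi (2 * j)"
    by (metis mult.left_commute)
  then have "k_alpha ^ (2 * k + 2) * k_s ^ nat (N + 2 * i) = k_s ^ nat (N + 2 * j)"
    unfolding x by (simp only: up)
  then show False using k_alpha_k_s_independent by fastforce
qed

context bmw_relations
begin

text \<open>
  On the hook \<open>h\<^bsub>n-1\<^esub>\<close> the full twist \<open>T\<^sub>n\<close> acts as \<open>\<alpha>\<^sup>-\<^sup>2 T\<^bsub>n-2\<^esub>\<close>. So if a polynomial vanishes at
  \<open>T\<^bsub>n-2\<^esub>\<close>, the one whose roots are multiplied by \<open>\<alpha>\<^sup>-\<^sup>2\<close> kills the hook when it is evaluated at \<open>T\<^sub>n\<close>.
\<close>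

lemma T_root_prod_h:
  assumes n: "n = Suc (Suc m)" and central: "\<And>x. x \<in> carrier A \<Longrightarrow> T n \<otimes> x = x \<otimes> T n"
    and zero: "root_prod A (T m) cs = \<zero>"
  shows "root_prod A (T n) (map ((*) (inverse \<alpha> * inverse \<alpha>)) cs) \<otimes> h (Suc m) = \<zero>"
proof -
  let ?c = "inverse \<alpha> * inverse \<alpha>" and ?h = "h (Suc m)"
  have c: "T n \<in> carrier A" "T m \<in> carrier A" "?h \<in> carrier A"
    using n by (auto intro!: T_closed h_closed simp del: full_twist.simps)
  have "root_prod A (T n) (map ((*) ?c) cs) \<otimes> ?h = ?c ^ length cs \<odot> (root_prod A (T m) cs \<otimes> ?h)" for cs
  proof (induction cs)
    case Nil
    show ?case using c by simp
  next
    case (Cons x cs)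
    let ?p = "root_prod A (T m) cs" and ?l = "linear_factor A (T n) (?c * x)"
      and ?l' = "linear_factor A (T m) x"
    have cl: "?p \<in> carrier A" "?l \<in> carrier A" "?l' \<in> carrier A"
      "root_prod A (T n) (map ((*) ?c) cs) \<in> carrier A" using c by blast+
    have lp: "?l \<otimes> ?p = ?p \<otimes> ?l"
      using central[OF cl(1)] c(1) cl(1) by (simp add: linear_factor_def l_distr r_distr)
    have l'p: "?p \<otimes> ?l' = ?l' \<otimes> ?p"
      using intertwine_root_prod[of "T m" "T m" ?l' cs] c(2) cl(3)
      by (simp add: linear_factor_def l_distr r_distr)
    have Tnh: "T n \<otimes> ?h = ?c \<odot> (T m \<otimes> ?h)" using T_h[of m] n by simp
    have lh: "?l \<otimes> ?h = ?c \<odot> (?l' \<otimes> ?h)"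
      using c by (simp add: linear_factor_def l_distr smult_r_distr Tnh)
    have "root_prod A (T n) (map ((*) ?c) (x # cs)) \<otimes> ?h
        = ?l \<otimes> (root_prod A (T n) (map ((*) ?c) cs) \<otimes> ?h)"
      using c cl by (simp add: m_assoc)
    also have "\<dots> = ?c ^ length cs \<odot> ((?l \<otimes> ?p) \<otimes> ?h)"
      unfolding Cons.IH using c cl by (simp add: m_assoc)
    also have "\<dots> = ?c ^ length cs \<odot> (?p \<otimes> (?l \<otimes> ?h))"
      unfolding lp using c cl by (simp add: m_assoc)
    also have "\<dots> = ?c ^ length (x # cs) \<odot> ((?p \<otimes> ?l') \<otimes> ?h)"
      unfolding lh using c cl by (simp add: m_assoc mult.commute)
    also have "\<dots> = ?c ^ length (x # cs) \<odot> (root_prod A (T m) (x # cs) \<otimes> ?h)"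
      unfolding l'p by simp
    finally show ?case .
  qed
  with zero c show ?thesis by simp
qed

end

section \<open>The Birman-Murakami-Wenzl algebra and its hook ideal\<close>

lemma gen_in_BMW_free:
  "g \<in> bmw_gens n \<Longrightarrow> gen g \<in> carrier (BMW_free n)"
  by (simp add: single_in_free_algebra)

lemma scal_in_BMW_free: "scal c \<in> carrier (BMW_free n)"
  by (simp add: single_in_free_algebra)

lemma one_in_BMW_free: "1 \<in> carrier (BMW_free n)"
  by (simp add: carrier_free_algebra)

lemma BMW_free_minus_closed:
  "x \<in> carrier (BMW_free n) \<Longrightarrow> y \<in> carrier (BMW_free n) \<Longrightarrow> x - y \<in> carrier (BMW_free n)"
  using Poly_Mapping.keys_diff[of x y] by (auto simp: carrier_free_algebra)

lemmas BMW_free_closed = gen_in_BMW_free scal_in_BMW_free one_in_BMW_free BMW_free_minus_closed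
  free_algebra_mult_closed free_algebra_add_closed

lemma gens_in_bmw_gens:
  "1 \<le> i \<Longrightarrow> i < n \<Longrightarrow> PosX i \<in> bmw_gens n"
  "1 \<le> i \<Longrightarrow> i < n \<Longrightarrow> NegX i \<in> bmw_gens n"
  "1 \<le> i \<Longrightarrow> i < n \<Longrightarrow> Hook i \<in> bmw_gens n"
  by (auto simp: bmw_gens_def)

lemma bmw_relators_subset: "bmw_relators n \<subseteq> carrier (BMW_free n)"
proof
  fix x assume "x \<in> bmw_relators n"
  then show "x \<in> carrier (BMW_free n)"
    by cases (auto intro!: BMW_free_closed gens_in_bmw_gens)
qed

lemma algebra_ideal_BMW_rel: "algebra_ideal (BMW_free n) (BMW_rel n)"
proof -
  interpret scalar_algebra "BMW_free n" by (rule scalar_algebra_free_algebra)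
  show ?thesis unfolding BMW_rel_def
    by (intro algebra_ideal.intro scalar_algebra_axioms genideal_ideal bmw_relators_subset)
qed

abbreviation bmw_class :: "nat \<Rightarrow> bmw_free \<Rightarrow> bmw_free set" where
  "bmw_class n x \<equiv> BMW_rel n +>\<^bsub>BMW_free n\<^esub> x"

lemma bmw_class_hom: "scalar_algebra_hom (BMW_free n) (BMW n) (bmw_class n)"
  unfolding BMW_def by (rule algebra_ideal.q_hom[OF algebra_ideal_BMW_rel])

text \<open>
  The inclusion of \<open>m\<close> strands into \<open>n\<close> strands, read on the free algebras.
\<close>

lemma BMW_rel_mono:
  assumes "m \<le> n"
  shows "BMW_rel m \<subseteq> BMW_rel n"
proof -
  interpret m: scalar_algebra "BMW_free m" by (rule scalar_algebra_free_algebra)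
  interpret n: scalar_algebra "BMW_free n" by (rule scalar_algebra_free_algebra)
  have gens: "bmw_gens m \<subseteq> bmw_gens n" using assms by (auto simp: bmw_gens_def)
  have sub: "carrier (BMW_free m) \<subseteq> carrier (BMW_free n)"
    using gens by (fastforce simp: carrier_free_algebra)
  have "ring_hom_ring (BMW_free m) (BMW_free n) (\<lambda>x. x)"
    by (rule ring_hom_ringI) (use sub m.ring_axioms n.ring_axioms in auto)
  then have ideal: "ideal {x \<in> carrier (BMW_free m). x \<in> BMW_rel n} (BMW_free m)"
    using algebra_ideal_BMW_rel[of n] unfolding algebra_ideal_def
    by (auto dest: ring_hom_ring.ideal_vimage)
  have "bmw_relators m \<subseteq> bmw_relators n"
  proof
    fix x assume "x \<in> bmw_relators m"
    then show "x \<in> bmw_relators n"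
      by induction (rule bmw_relators.intros; use assms in simp)+
  qed
  then have "bmw_relators m \<subseteq> {x \<in> carrier (BMW_free m). x \<in> BMW_rel n}"
    using bmw_relators_subset[of m] n.genideal_self[OF bmw_relators_subset[of n]]
    by (auto simp: BMW_rel_def)
  from m.genideal_minimal[OF ideal this] show ?thesis
    unfolding BMW_rel_def[of m] by auto
qed

lemma bmw_relations_BMW:
  "bmw_relations (BMW n) n (\<lambda>i. bmw_class n (pe i)) (\<lambda>i. bmw_class n (ne i))
     (\<lambda>i. bmw_class n (hk i)) k_alpha k_s"
proof -
  interpret F: algebra_ideal "BMW_free n" "BMW_rel n" by (rule algebra_ideal_BMW_rel)
  interpret q: scalar_algebra_hom "BMW_free n" "BMW n" "bmw_class n" by (rule bmw_class_hom)
  let ?q = "bmw_class n" and ?C = "carrier (BMW_free n)"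
  have rel: "?q x = ?q y" if "x - y \<in> bmw_relators n" "x \<in> ?C" "y \<in> ?C" for x y
    using F.q_eq_iff[OF that(2,3)] that F.genideal_self[OF bmw_relators_subset[of n]]
    by (auto simp only: free_algebra_minus BMW_rel_def[symmetric])
  have mult: "?q (x * y) = ?q x \<otimes>\<^bsub>BMW n\<^esub> ?q y" if "x \<in> ?C" "y \<in> ?C" for x y
    using q.f_mult[OF that] by simp
  have smult: "?q (scal c) \<otimes>\<^bsub>BMW n\<^esub> x = c \<odot>\<^bsub>BMW n\<^esub> x" if "x \<in> carrier (BMW n)" for x c
    using q.f_smult[OF F.one_closed, of c] q.f_one that by simp
  have minus: "?q (x - y) = ?q x \<ominus>\<^bsub>BMW n\<^esub> ?q y" if "x \<in> ?C" "y \<in> ?C" for x y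
    using q.f_minus[OF that] that by (simp add: free_algebra_minus)
  have one: "?q 1 = \<one>\<^bsub>BMW n\<^esub>" using q.f_one by simp
  note closed = BMW_free_closed gens_in_bmw_gens
  show ?thesis
  proof
    show "k_alpha \<noteq> 0" "k_s \<noteq> 0" "k_s \<noteq> inverse k_s"
      by (rule k_alpha_nonzero k_s_nonzero k_s_neq_inverse)+
  next
    fix i assume i: "1 \<le> i" "i + 1 < n"
    have c: "pe i \<in> ?C" "pe (i + 1) \<in> ?C" using i by (auto intro!: closed)
    show "?q (pe i) \<otimes>\<^bsub>BMW n\<^esub> ?q (pe (i + 1)) \<otimes>\<^bsub>BMW n\<^esub> ?q (pe i)
        = ?q (pe (i + 1)) \<otimes>\<^bsub>BMW n\<^esub> ?q (pe i) \<otimes>\<^bsub>BMW n\<^esub> ?q (pe (i + 1))"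
      using rel[OF bmw_relators.braid[OF i]] c by (simp only: mult free_algebra_mult_closed)
  next
    fix i j assume ij: "1 \<le> i" "i < n" "1 \<le> j" "j < n" "i + 2 \<le> j \<or> j + 2 \<le> i"
    have c: "pe i \<in> ?C" "pe j \<in> ?C" using ij by (auto intro!: closed)
    show "?q (pe i) \<otimes>\<^bsub>BMW n\<^esub> ?q (pe j) = ?q (pe j) \<otimes>\<^bsub>BMW n\<^esub> ?q (pe i)"
      using rel[OF bmw_relators.far_comm[OF ij]] c by (simp only: mult free_algebra_mult_closed)
  next
    fix i assume i: "2 \<le> i" "i < n"
    have c: "pe (i - 1) \<in> ?C" "ne (i - 1) \<in> ?C" "hk i \<in> ?C" using i by (auto intro!: closed)
    show "?q (hk i) \<otimes>\<^bsub>BMW n\<^esub> ?q (pe (i - 1)) \<otimes>\<^bsub>BMW n\<^esub> ?q (hk i) = k_alpha \<odot>\<^bsub>BMW n\<^esub> ?q (hk i)"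
      using rel[OF bmw_relators.hook_pos[OF i]] c
      by (simp only: mult smult free_algebra_mult_closed scal_in_BMW_free q.f_closed)
    show "?q (hk i) \<otimes>\<^bsub>BMW n\<^esub> ?q (ne (i - 1)) \<otimes>\<^bsub>BMW n\<^esub> ?q (hk i) = inverse k_alpha \<odot>\<^bsub>BMW n\<^esub> ?q (hk i)"
      using rel[OF bmw_relators.hook_neg[OF i]] c
      by (simp only: mult smult free_algebra_mult_closed scal_in_BMW_free q.f_closed)
  next
    fix i assume i: "1 \<le> i" "i < n"
    have c: "pe i \<in> ?C" "ne i \<in> ?C" "hk i \<in> ?C" using i by (auto intro!: closed)
    then show "?q (pe i) \<in> carrier (BMW n)" "?q (ne i) \<in> carrier (BMW n)" "?q (hk i) \<in> carrier (BMW n)"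
      by auto
    show "?q (pe i) \<otimes>\<^bsub>BMW n\<^esub> ?q (ne i) = \<one>\<^bsub>BMW n\<^esub>"
      using rel[OF bmw_relators.inv_right[OF i]] c
      by (simp only: mult one free_algebra_mult_closed one_in_BMW_free)
    show "?q (ne i) \<otimes>\<^bsub>BMW n\<^esub> ?q (pe i) = \<one>\<^bsub>BMW n\<^esub>"
      using rel[OF bmw_relators.inv_left[OF i]] c
      by (simp only: mult one free_algebra_mult_closed one_in_BMW_free)
    show "?q (hk i) \<otimes>\<^bsub>BMW n\<^esub> ?q (pe i) = inverse k_alpha \<odot>\<^bsub>BMW n\<^esub> ?q (hk i)"
      using rel[OF bmw_relators.kink[OF i]] c
      by (simp only: mult smult free_algebra_mult_closed scal_in_BMW_free q.f_closed)
    show "?q (pe i) \<ominus>\<^bsub>BMW n\<^esub> ?q (ne i) = (k_s - inverse k_s) \<odot>\<^bsub>BMW n\<^esub> (\<one>\<^bsub>BMW n\<^esub> \<ominus>\<^bsub>BMW n\<^esub> ?q (hk i))"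
      using rel[OF bmw_relators.skein[OF i]] c
      by (simp only: minus smult one free_algebra_mult_closed scal_in_BMW_free one_in_BMW_free
          BMW_free_minus_closed mult q.f_closed q.B.one_closed q.B.minus_closed)
  qed
qed

abbreviation bmw_twist :: "nat \<Rightarrow> bmw_free set" where
  "bmw_twist n \<equiv> full_twist (BMW n) (\<lambda>i. bmw_class n (pe i)) n"

text \<open>
  It suffices to commute with the generators. The inverse crossings and the hooks are determined by the
  crossings, and with these the full twist commutes by the braid relations alone.
\<close>

lemma bmw_twist_central:
  assumes "x \<in> carrier (BMW n)"
  shows "bmw_twist n \<otimes>\<^bsub>BMW n\<^esub> x = x \<otimes>\<^bsub>BMW n\<^esub> bmw_twist n"
proof -
  interpret F: algebra_ideal "BMW_free n" "BMW_rel n" by (rule algebra_ideal_BMW_rel)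
  interpret q: scalar_algebra_hom "BMW_free n" "BMW n" "bmw_class n" by (rule bmw_class_hom)
  interpret bmw_relations "BMW n" n "\<lambda>i. bmw_class n (pe i)" "\<lambda>i. bmw_class n (ne i)"
    "\<lambda>i. bmw_class n (hk i)" k_alpha k_s by (rule bmw_relations_BMW)
  let ?T = "bmw_twist n" and ?q = "bmw_class n"
  have T: "?T \<in> carrier (BMW n)" by (rule T_closed) simp
  have q_mult: "?q (x * y) = ?q x \<otimes>\<^bsub>BMW n\<^esub> ?q y"
    and q_add: "?q (x + y) = ?q x \<oplus>\<^bsub>BMW n\<^esub> ?q y"
    if "x \<in> carrier (BMW_free n)" "y \<in> carrier (BMW_free n)" for x y
    using q.f_mult[OF that] q.f_add[OF that] by simp_all
  have e: "?q (pe i) \<otimes>\<^bsub>BMW n\<^esub> ?T = ?T \<otimes>\<^bsub>BMW n\<^esub> ?q (pe i)" if "1 \<le> i" "i < n" for i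
    by (rule e_T_commute) (use that in auto)
  from assms obtain f where f: "f \<in> carrier (BMW_free n)" "x = ?q f"
    unfolding BMW_def F.Q_simps(1) by auto
  have "?T \<otimes>\<^bsub>BMW n\<^esub> ?q f = ?q f \<otimes>\<^bsub>BMW n\<^esub> ?T"
    using f(1)
  proof (induction f rule: free_algebra_induct)
    case (scalar c)
    have "?q (scal c) = c \<odot>\<^bsub>BMW n\<^esub> \<one>\<^bsub>BMW n\<^esub>"
      using q.f_smult[OF F.one_closed, of c] q.f_one by simp
    then show ?case using T by simp
  next
    case (gen g)
    then obtain i where i: "1 \<le> i" "i < n" "g = PosX i \<or> g = NegX i \<or> g = Hook i"
      by (auto simp: bmw_gens_def)
    show ?case
      using e[OF i(1,2)] intertwine_e'[OF T i(1,2) i(1,2) e[OF i(1,2), symmetric]]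
        intertwine_h[OF T i(1,2) i(1,2) e[OF i(1,2), symmetric]] i(3) by auto
  next
    case (add f g)
    then show ?case using T by (simp add: q_add q.B.l_distr q.B.r_distr)
  next
    case (mult f g)
    then show ?case using T q.B.commute_mult[of ?T "?q f" "?q g"] by (simp add: q_mult)
  qed
  then show ?thesis by (simp add: f(2))
qed

lemma algebra_ideal_hook_ideal: "algebra_ideal (BMW n) (hook_ideal n)"
proof -
  interpret q: scalar_algebra_hom "BMW_free n" "BMW n" "bmw_class n" by (rule bmw_class_hom)
  have "ideal (hook_ideal n) (BMW n)"
  proof (cases "2 \<le> n")
    case True
    have "bmw_hook n (n - 1) \<in> carrier (BMW n)"
      unfolding bmw_hook_def by (rule q.f_closed) (use True in \<open>auto intro!: gen_in_BMW_free gens_in_bmw_gens\<close>)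
    with True show ?thesis by (simp add: hook_ideal_def q.B.genideal_ideal)
  qed (simp add: hook_ideal_def q.B.zeroideal)
  then show ?thesis by (intro algebra_ideal.intro q.B.scalar_algebra_axioms)
qed

lemma hook_in_hook_ideal:
  assumes "1 \<le> i" "i < n"
  shows "bmw_class n (hk i) \<in> hook_ideal n"
proof -
  interpret I: algebra_ideal "BMW n" "hook_ideal n" by (rule algebra_ideal_hook_ideal)
  interpret bmw_relations "BMW n" n "\<lambda>i. bmw_class n (pe i)" "\<lambda>i. bmw_class n (ne i)"
    "\<lambda>i. bmw_class n (hk i)" k_alpha k_s by (rule bmw_relations_BMW)
  from assms have "i \<le> n - 1" by simp
  then show ?thesis using assms(1)
  proof (induction i rule: inc_induct)
    case base
    then have "2 \<le> n" using assms by simp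
    then show ?case using I.genideal_self'[OF h_closed[of "n - 1"]]
      by (simp add: hook_ideal_def bmw_hook_def)
  next
    case (step j)
    have j: "1 \<le> j" "Suc j < n" using step.prems step.hyps by auto
    obtain x y where xy: "x \<in> carrier (BMW n)" "y \<in> carrier (BMW n)"
      "bmw_class n (hk j) = x \<otimes>\<^bsub>BMW n\<^esub> bmw_class n (hk (Suc j)) \<otimes>\<^bsub>BMW n\<^esub> y"
      by (rule h_in_ideal_down[OF j])
    have "bmw_class n (hk (Suc j)) \<in> hook_ideal n" by (rule step.IH) simp
    then show ?case unfolding xy(3) using xy(1,2) by (intro I.I_r_closed I.I_l_closed)
  qed
qed

lemma hecke_relations_Hecke:
  "hecke_relations (Hecke n) n (\<lambda>i. hecke_proj n (bmw_class n (pe i)))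
     (\<lambda>i. hecke_proj n (bmw_class n (ne i))) (\<lambda>i. hecke_proj n (bmw_class n (hk i))) k_alpha k_s"
proof -
  interpret I: algebra_ideal "BMW n" "hook_ideal n" by (rule algebra_ideal_hook_ideal)
  have "bmw_relations (Hecke n) n (\<lambda>i. hecke_proj n (bmw_class n (pe i)))
     (\<lambda>i. hecke_proj n (bmw_class n (ne i))) (\<lambda>i. hecke_proj n (bmw_class n (hk i))) k_alpha k_s"
    unfolding Hecke_def hecke_proj_def
    by (rule scalar_algebra_hom.bmw_relations_image[OF I.q_hom bmw_relations_BMW])
  moreover have "hecke_proj n (bmw_class n (hk i)) = \<zero>\<^bsub>Hecke n\<^esub>" if "1 \<le> i" "i < n" for i
    unfolding Hecke_def hecke_proj_def
    using hook_in_hook_ideal[OF that] by (simp add: I.q_eq_zero_iff I.Icarr)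
  ultimately show ?thesis
    by (intro hecke_relations.intro hecke_relations_axioms.intro) auto
qed

lemma twist_annihilated_mod_hook_ideal:
  "\<exists>as. set as \<subseteq> even_powers k_s \<and> root_prod (BMW n) (bmw_twist n) as \<in> hook_ideal n"
proof -
  interpret I: algebra_ideal "BMW n" "hook_ideal n" by (rule algebra_ideal_hook_ideal)
  interpret B: bmw_relations "BMW n" n "\<lambda>i. bmw_class n (pe i)" "\<lambda>i. bmw_class n (ne i)"
    "\<lambda>i. bmw_class n (hk i)" k_alpha k_s by (rule bmw_relations_BMW)
  interpret H: hecke_relations "Hecke n" n "\<lambda>i. hecke_proj n (bmw_class n (pe i))"
    "\<lambda>i. hecke_proj n (bmw_class n (ne i))" "\<lambda>i. hecke_proj n (bmw_class n (hk i))" k_alpha k_s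
    by (rule hecke_relations_Hecke)
  interpret q: scalar_algebra_hom "BMW n" "Hecke n" "hecke_proj n"
    using I.q_hom by (simp add: Hecke_def hecke_proj_def[abs_def])
  from H.T_annihilated[of n] obtain as where as: "set as \<subseteq> even_powers k_s"
    "root_prod (Hecke n) (H.T n) as = \<zero>\<^bsub>Hecke n\<^esub>" by auto
  have "bmw_twist n \<in> carrier (BMW n) \<and> hecke_proj n (bmw_twist n) = H.T n"
    by (rule q.f_full_twist) (rule B.e_closed)
  then have "hecke_proj n (root_prod (BMW n) (bmw_twist n) as) = \<zero>\<^bsub>Hecke n\<^esub>"
    and "root_prod (BMW n) (bmw_twist n) as \<in> carrier (BMW n)"
    using as by (auto simp: q.f_root_prod)
  then have "root_prod (BMW n) (bmw_twist n) as \<in> hook_ideal n"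
    by (simp add: Hecke_def hecke_proj_def I.q_eq_zero_iff)
  with as show ?thesis by auto
qed

text \<open>
  The polynomial in the full twist kills the generator of the ideal and is central, so it kills the
  whole ideal. Its roots come from the algebra on two strands less. The hypothesis is stated in the
  free algebra, where that algebra and the present one can be compared.
\<close>

lemma twist_roots_kill_hook_ideal:
  assumes zero: "root_prod (BMW_free m) (full_twist (BMW_free m) pe m) cs \<in> BMW_rel m"
    and y: "y \<in> hook_ideal (Suc (Suc m))"
  shows "root_prod (BMW (Suc (Suc m))) (bmw_twist (Suc (Suc m)))
           (map ((*) (inverse k_alpha * inverse k_alpha)) cs) \<otimes>\<^bsub>BMW (Suc (Suc m))\<^esub> y
         = \<zero>\<^bsub>BMW (Suc (Suc m))\<^esub>"
proof -
  define n where "n = Suc (Suc m)"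
  interpret F: algebra_ideal "BMW_free n" "BMW_rel n" by (rule algebra_ideal_BMW_rel)
  interpret q: scalar_algebra_hom "BMW_free n" "BMW n" "bmw_class n" by (rule bmw_class_hom)
  interpret B: bmw_relations "BMW n" n "\<lambda>i. bmw_class n (pe i)" "\<lambda>i. bmw_class n (ne i)"
    "\<lambda>i. bmw_class n (hk i)" k_alpha k_s by (rule bmw_relations_BMW)
  let ?T = "full_twist (BMW_free n) pe m"
  have jm: "jucys_murphy (BMW_free m) pe k = jucys_murphy (BMW_free n) pe k" for k
    by (induction k) simp_all
  have ft: "full_twist (BMW_free m) pe k = full_twist (BMW_free n) pe k" for k
    by (induction k) (simp_all add: jm)
  have rp: "root_prod (BMW_free m) x cs = root_prod (BMW_free n) x cs" for x
    by (induction cs) (simp_all add: linear_factor_def)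
  have T: "?T \<in> carrier (BMW_free n) \<and> bmw_class n ?T = B.T m"
    by (rule q.f_full_twist) (auto simp: n_def intro!: gen_in_BMW_free gens_in_bmw_gens)
  have "root_prod (BMW_free n) ?T cs \<in> BMW_rel n"
    using zero BMW_rel_mono[of m n] unfolding ft rp by (auto simp: n_def)
  then have "bmw_class n (root_prod (BMW_free n) ?T cs) = \<zero>\<^bsub>BMW n\<^esub>"
    using F.q_eq_zero_iff[OF F.root_prod_closed] T by (simp add: BMW_def)
  then have "root_prod (BMW n) (B.T m) cs = \<zero>\<^bsub>BMW n\<^esub>"
    using T q.f_root_prod[of ?T cs] by simp
  from B.T_root_prod_h[OF n_def bmw_twist_central this]
  have h: "root_prod (BMW n) (bmw_twist n) (map ((*) (inverse k_alpha * inverse k_alpha)) cs)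
      \<otimes>\<^bsub>BMW n\<^esub> bmw_class n (hk (Suc m)) = \<zero>\<^bsub>BMW n\<^esub>" (is "?g \<otimes>\<^bsub>BMW n\<^esub> _ = _")
    by simp
  have Tn: "bmw_twist n \<in> carrier (BMW n)" by (rule B.T_closed) simp
  then have g: "?g \<in> carrier (BMW n)" by blast
  have "ideal {x \<in> carrier (BMW n). ?g \<otimes>\<^bsub>BMW n\<^esub> x = \<zero>\<^bsub>BMW n\<^esub>} (BMW n)"
  proof (rule q.B.ideal_annihilator_of_central[OF g])
    fix x assume x: "x \<in> carrier (BMW n)"
    show "?g \<otimes>\<^bsub>BMW n\<^esub> x = x \<otimes>\<^bsub>BMW n\<^esub> ?g"
      using q.B.intertwine_root_prod[OF Tn Tn x bmw_twist_central[OF x, symmetric]] by simp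
  qed
  moreover have gen: "hook_ideal n = Idl\<^bsub>BMW n\<^esub> {bmw_class n (hk (Suc m))}"
    by (simp add: hook_ideal_def bmw_hook_def n_def)
  ultimately have "hook_ideal n \<subseteq> {x \<in> carrier (BMW n). ?g \<otimes>\<^bsub>BMW n\<^esub> x = \<zero>\<^bsub>BMW n\<^esub>}"
    using h B.h_closed[of "Suc m"] unfolding gen
    by (intro q.B.genideal_minimal) (simp_all add: n_def)
  then show ?thesis using y unfolding n_def by blast
qed

text \<open>
  One polynomial sends the full twist into the hook ideal and another one kills that ideal, so
  their product kills the full twist; induction in steps of two strands.
\<close>

lemma twist_annihilated:
  "\<exists>cs. set cs \<subseteq> twist_roots k_alpha k_s \<and>
     root_prod (BMW_free n) (full_twist (BMW_free n) pe n) cs \<in> BMW_rel n"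
proof (induction n rule: less_induct)
  case (less n)
  interpret F: algebra_ideal "BMW_free n" "BMW_rel n" by (rule algebra_ideal_BMW_rel)
  interpret q: scalar_algebra_hom "BMW_free n" "BMW n" "bmw_class n" by (rule bmw_class_hom)
  have T: "full_twist (BMW_free n) pe n \<in> carrier (BMW_free n) \<and>
      bmw_class n (full_twist (BMW_free n) pe n) = bmw_twist n"
    by (rule q.f_full_twist) (auto intro!: gen_in_BMW_free gens_in_bmw_gens)
  have Tn: "bmw_twist n \<in> carrier (BMW n)" using T q.f_closed by metis
  have "\<exists>cs. set cs \<subseteq> twist_roots k_alpha k_s \<and> root_prod (BMW n) (bmw_twist n) cs = \<zero>\<^bsub>BMW n\<^esub>"
  proof (cases "2 \<le> n")
    case False
    then have "n = 0 \<or> n = Suc 0" by auto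
    then have "bmw_twist n = \<one>\<^bsub>BMW n\<^esub>"
      using q.B.l_one[OF q.B.one_closed] by (elim disjE) simp_all
    then show ?thesis
      using subsetD[OF even_powers_subset_twist_roots one_in_even_powers] q.B.root_prod_one_one
      by (intro exI[of _ "[1]"]) (auto simp del: root_prod_Cons)
  next
    case True
    then obtain m where m: "n = Suc (Suc m)" by (metis add_2_eq_Suc le_Suc_ex)
    from less[of m] m obtain cs where cs: "set cs \<subseteq> twist_roots k_alpha k_s"
      "root_prod (BMW_free m) (full_twist (BMW_free m) pe m) cs \<in> BMW_rel m" by auto
    from twist_annihilated_mod_hook_ideal[of n] obtain as where as: "set as \<subseteq> even_powers k_s"
      "root_prod (BMW n) (bmw_twist n) as \<in> hook_ideal n" by auto
    let ?cs = "map ((*) (inverse k_alpha * inverse k_alpha)) cs"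
    have "root_prod (BMW n) (bmw_twist n) (?cs @ as) = \<zero>\<^bsub>BMW n\<^esub>"
      unfolding q.B.root_prod_append[OF Tn]
      by (rule twist_roots_kill_hook_ideal[OF cs(2), folded m, OF as(2)])
    moreover have "set as \<subseteq> twist_roots k_alpha k_s"
      by (rule subset_trans[OF as(1) even_powers_subset_twist_roots])
    moreover have "set ?cs \<subseteq> twist_roots k_alpha k_s"
      using cs(1) by (auto intro!: shift_in_twist_roots)
    moreover have "set (?cs @ as) = set ?cs \<union> set as" by simp
    ultimately show ?thesis by (metis Un_least)
  qed
  then obtain cs where cs: "set cs \<subseteq> twist_roots k_alpha k_s"
    "root_prod (BMW n) (bmw_twist n) cs = \<zero>\<^bsub>BMW n\<^esub>" by auto
  have "bmw_class n (root_prod (BMW_free n) (full_twist (BMW_free n) pe n) cs) = \<zero>\<^bsub>BMW n\<^esub>"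
    using T cs(2) q.f_root_prod by simp
  then have "root_prod (BMW_free n) (full_twist (BMW_free n) pe n) cs \<in> BMW_rel n"
    using F.q_eq_zero_iff[OF F.root_prod_closed] T by (simp add: BMW_def)
  with cs(1) show ?case by blast
qed

text \<open>
  Bezout's identity \<open>u f + v g = 1\<close> for the polynomials \<open>f\<close>, with \<open>f(T) \<in> I\<^sub>n\<close>, and \<open>g\<close>, with \<open>g(T) I\<^sub>n = 0\<close>:
  the element \<open>v g\<close> is \<open>1\<close> modulo \<open>I\<^sub>n\<close> and kills \<open>I\<^sub>n\<close> from both sides.
\<close>

lemma hook_ideal_complement:
  assumes "1 \<le> n"
  obtains z where "z \<in> carrier (BMW n)" "\<one>\<^bsub>BMW n\<^esub> \<ominus>\<^bsub>BMW n\<^esub> z \<in> hook_ideal n"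
    "\<And>y. y \<in> hook_ideal n \<Longrightarrow> z \<otimes>\<^bsub>BMW n\<^esub> y = \<zero>\<^bsub>BMW n\<^esub>"
    "\<And>y. y \<in> hook_ideal n \<Longrightarrow> y \<otimes>\<^bsub>BMW n\<^esub> z = \<zero>\<^bsub>BMW n\<^esub>"
proof -
  interpret I: algebra_ideal "BMW n" "hook_ideal n" by (rule algebra_ideal_hook_ideal)
  show ?thesis
  proof (cases "2 \<le> n")
    case False
    then have "hook_ideal n = {\<zero>\<^bsub>BMW n\<^esub>}" by (simp add: hook_ideal_def)
    then show ?thesis by (intro that[of "\<one>\<^bsub>BMW n\<^esub>"]) (auto simp: I.r_neg a_minus_def)
  next
    case True
    then obtain m where m: "n = Suc (Suc m)" by (metis add_2_eq_Suc le_Suc_ex)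
    from twist_annihilated[of m] obtain cs where cs: "set cs \<subseteq> twist_roots k_alpha k_s"
      "root_prod (BMW_free m) (full_twist (BMW_free m) pe m) cs \<in> BMW_rel m" by auto
    from twist_annihilated_mod_hook_ideal[of n] obtain as where as: "set as \<subseteq> even_powers k_s"
      "root_prod (BMW n) (bmw_twist n) as \<in> hook_ideal n" by auto
    interpret B: bmw_relations "BMW n" n "\<lambda>i. bmw_class n (pe i)" "\<lambda>i. bmw_class n (ne i)"
      "\<lambda>i. bmw_class n (hk i)" k_alpha k_s by (rule bmw_relations_BMW)
    let ?cs = "map ((*) (inverse k_alpha * inverse k_alpha)) cs"
    let ?f = "root_prod (BMW n) (bmw_twist n) as" and ?g = "root_prod (BMW n) (bmw_twist n) ?cs"
    have T: "bmw_twist n \<in> carrier (BMW n)" by (rule B.T_closed) simp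
    have "set as \<inter> set ?cs = {}"
      using as(1) cs(1) even_powers_disjoint_shifted_roots by fastforce
    from I.comaximal_root_prods[OF T this] obtain u v where
      uv: "u \<in> carrier (BMW n)" "v \<in> carrier (BMW n)" "v \<otimes>\<^bsub>BMW n\<^esub> ?g = ?g \<otimes>\<^bsub>BMW n\<^esub> v"
        "u \<otimes>\<^bsub>BMW n\<^esub> ?f \<oplus>\<^bsub>BMW n\<^esub> v \<otimes>\<^bsub>BMW n\<^esub> ?g = \<one>\<^bsub>BMW n\<^esub>" by metis
    have f: "?f \<in> carrier (BMW n)" and g: "?g \<in> carrier (BMW n)" using T by blast+
    have gI: "?g \<otimes>\<^bsub>BMW n\<^esub> y = \<zero>\<^bsub>BMW n\<^esub>" if "y \<in> hook_ideal n" for y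
      using twist_roots_kill_hook_ideal[OF cs(2), of y] that unfolding m .
    show ?thesis
    proof (rule that[of "v \<otimes>\<^bsub>BMW n\<^esub> ?g"])
      have "\<one>\<^bsub>BMW n\<^esub> \<ominus>\<^bsub>BMW n\<^esub> v \<otimes>\<^bsub>BMW n\<^esub> ?g
          = (u \<otimes>\<^bsub>BMW n\<^esub> ?f \<oplus>\<^bsub>BMW n\<^esub> v \<otimes>\<^bsub>BMW n\<^esub> ?g) \<ominus>\<^bsub>BMW n\<^esub> v \<otimes>\<^bsub>BMW n\<^esub> ?g"
        unfolding uv(4) ..
      also have "\<dots> = u \<otimes>\<^bsub>BMW n\<^esub> ?f"
        using uv(1,2) f g by (simp add: a_minus_def I.a_assoc I.r_neg)
      finally show "\<one>\<^bsub>BMW n\<^esub> \<ominus>\<^bsub>BMW n\<^esub> v \<otimes>\<^bsub>BMW n\<^esub> ?g \<in> hook_ideal n"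
        using I.I_l_closed[OF as(2) uv(1)] by simp
    next
      fix y assume y: "y \<in> hook_ideal n"
      have yc: "y \<in> carrier (BMW n)" using y by (rule I.Icarr)
      show "v \<otimes>\<^bsub>BMW n\<^esub> ?g \<otimes>\<^bsub>BMW n\<^esub> y = \<zero>\<^bsub>BMW n\<^esub>"
        using uv(2) g yc gI[OF y] by (simp add: I.m_assoc)
      have "y \<otimes>\<^bsub>BMW n\<^esub> (v \<otimes>\<^bsub>BMW n\<^esub> ?g) = (y \<otimes>\<^bsub>BMW n\<^esub> ?g) \<otimes>\<^bsub>BMW n\<^esub> v"
        unfolding uv(3) using uv(2) g yc by (simp add: I.m_assoc)
      also have "y \<otimes>\<^bsub>BMW n\<^esub> ?g = ?g \<otimes>\<^bsub>BMW n\<^esub> y"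
        using I.intertwine_root_prod[OF T T yc bmw_twist_central[OF yc, symmetric]] .
      finally show "y \<otimes>\<^bsub>BMW n\<^esub> (v \<otimes>\<^bsub>BMW n\<^esub> ?g) = \<zero>\<^bsub>BMW n\<^esub>"
        using gI[OF y] uv(2) by simp
    qed (use uv(2) g in blast)
  qed
qed

theorem theorem3p1:
  fixes n :: nat
  assumes "1 \<le> n"
  shows "\<exists>!s. s \<in> extensional (carrier (Hecke n)) \<and>
           multiplicative_hom (Hecke n) (BMW n) s \<and>
           (\<forall>x \<in> carrier (Hecke n). hecke_proj n (s x) = x) \<and>
           (\<forall>x \<in> carrier (Hecke n). \<forall>y \<in> hook_ideal n.
              s x \<otimes>\<^bsub>BMW n\<^esub> y = \<zero>\<^bsub>BMW n\<^esub> \<and> y \<otimes>\<^bsub>BMW n\<^esub> s x = \<zero>\<^bsub>BMW n\<^esub>)"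
proof -
  from hook_ideal_complement[OF assms] obtain z where z:
    "z \<in> carrier (BMW n)" "\<one>\<^bsub>BMW n\<^esub> \<ominus>\<^bsub>BMW n\<^esub> z \<in> hook_ideal n"
    "\<And>y. y \<in> hook_ideal n \<Longrightarrow> z \<otimes>\<^bsub>BMW n\<^esub> y = \<zero>\<^bsub>BMW n\<^esub>"
    "\<And>y. y \<in> hook_ideal n \<Longrightarrow> y \<otimes>\<^bsub>BMW n\<^esub> z = \<zero>\<^bsub>BMW n\<^esub>" by metis
  from algebra_ideal.unique_section_annihilating_ideal[OF algebra_ideal_hook_ideal z]
  show ?thesis unfolding Hecke_def hecke_proj_def .
qed

end
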